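(* Let $X$ be a (real or complex) Banach space and let $T:X\to X$ be a compact linear operator. Then there exist finite-codimensional subspaces $Z\subseteq Y\subseteq X$ such that: (1) if $x\in X\setminus Y$, then $\|T^n(x)\|\to\infty$ as $n\to\infty$; (2) if $x\in Y\setminus Z$, then there exists $M>0$ such that $M^{-1}\le\|T^n(x)\|\le M$ for every $n$; (3) if $x\in Z$, then $\|T^n(x)\|\to 0$ as $n\to\infty$.
   Context: A subspace $Z$ of $X$ is finite-codimensional if $X/Z$ is finite-dimensional (codimension $0$ is allowed). *)

theory Defs
  imports "HOL-Analysis.Analysis"
begin

text \<open>Completeness and the real scalar multiplication come from \<^class>\<open>banach\<close>; a complex Banach
  space in addition carries a complex scalar multiplication extending the real one, for which the
  norm is homogeneous.\<close>

class complex_banach = banach +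
  fixes scaleC :: "complex \<Rightarrow> 'a \<Rightarrow> 'a"  (infixr \<open>*\<^sub>C\<close> 75)
  assumes scaleC_add_right: "c *\<^sub>C (x + y) = c *\<^sub>C x + c *\<^sub>C y"
    and scaleC_add_left: "(c + d) *\<^sub>C x = c *\<^sub>C x + d *\<^sub>C x"
    and scaleC_scaleC: "c *\<^sub>C (d *\<^sub>C x) = (c * d) *\<^sub>C x"
    and scaleC_of_real: "complex_of_real r *\<^sub>C x = r *\<^sub>R x"
    and norm_scaleC: "norm (c *\<^sub>C x) = cmod c * norm x"

lemma vector_space_scaleC: "vector_space (scaleC :: complex \<Rightarrow> 'a::complex_banach \<Rightarrow> 'a)"
  using scaleC_of_real[of 1]
  by unfold_locales
    (simp_all add: scaleC_add_right scaleC_add_left scaleC_scaleC)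

instantiation complex :: complex_banach
begin

definition scaleC_complex :: "complex \<Rightarrow> complex \<Rightarrow> complex"
  where "scaleC_complex c x = c * x"

instance
  by standard (simp_all add: scaleC_complex_def algebra_simps norm_mult scaleR_conv_of_real)

end

text \<open>The notions below take the scalar multiplication as a parameter, so that they apply to
  real spaces, via \<^term>\<open>scaleR\<close>, and to complex spaces, via \<^term>\<open>scaleC\<close>.\<close>

definition compact_operator ::
    "('k::field \<Rightarrow> 'a \<Rightarrow> 'a) \<Rightarrow> ('a::real_normed_vector \<Rightarrow> 'a) \<Rightarrow> bool"
  where "compact_operator smul T \<longleftrightarrow>
    Vector_Spaces.linear smul smul T \<and> (\<forall>S. bounded S \<longrightarrow> compact (closure (T ` S)))"

definition quot_class :: "'a::ab_group_add set \<Rightarrow> 'a \<Rightarrow> 'a set"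
  where "quot_class Z x = {x + z | z. z \<in> Z}"

text \<open>The elements of the quotient by \<open>Z\<close> are the classes \<^term>\<open>quot_class Z x\<close>, and linear
  combinations of classes are computed on representatives.  The quotient is finite-dimensional
  if it is spanned by the classes of the members of some finite set \<open>B\<close>.\<close>

definition finite_codim_subspace ::
    "('k::field \<Rightarrow> 'a \<Rightarrow> 'a) \<Rightarrow> 'a::ab_group_add set \<Rightarrow> bool"
  where "finite_codim_subspace smul Z \<longleftrightarrow>
    module.subspace smul Z \<and>
    (\<exists>B. finite B \<and> (\<forall>x. \<exists>c. quot_class Z x = quot_class Z (\<Sum>b\<in>B. smul (c b) b)))"

end

theory Submission
  imports Defs
begin

text \<open>The two sets are the only possible ones: \<open>Z\<close> consists of the vectors whose orbit tends to \<open>0\<close> and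
  \<open>Y\<close> of the vectors whose orbit is bounded.  Both are closed under complex
  scalars where these exist, and finite codimension over the reals implies it over the complex
  numbers, so all work happens over the reals.  The proof replaces spectral theory by compactness arguments about orbits.

  For \<open>r > 1\<close> let \<open>E r\<close> be the space of all \<open>x\<close> that have a backward orbit
  \<open>\<dots> \<mapsto> u 2 \<mapsto> u 1 \<mapsto> u 0 = x\<close> with \<open>\<parallel>u n\<parallel> = O(r ^ n)\<close>; morally it collects the part of the spectrum
  outside the disc of radius \<open>1 / r\<close>.

  \<^item> \<open>E r\<close> is finite-dimensional, by counting (\<open>card_independent_backward_space\<close>).  The image of the
    unit ball is covered by finitely many, say \<open>k\<close>, balls of radius \<open>1 / (4 * r)\<close>, so the \<open>m\<close>-th image
    of a ball is covered by \<open>k ^ m\<close> balls whose radii are smaller by the factor \<open>(4 * r) ^ - m\<close>.  A grid with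
    \<open>2 ^ m\<close> steps along each of \<open>d\<close> independent vectors of \<open>E r\<close> lies in such an image, and for
    large \<open>m\<close> its points need different balls, so \<open>2 ^ d \<le> k\<close>.

  \<^item> Take \<open>r\<close> with \<open>dim (E r)\<close> minimal, so that \<open>E s = E r\<close> for \<open>1 < s \<le> r\<close>, and write \<open>E\<close> for it.
    Then \<open>T\<close> contracts modulo \<open>E\<close>: the distance of \<open>T ^ n x\<close> from \<open>E\<close> is \<open>O(r ^ - n)\<close>
    (\<open>infdist_E_decay\<close>), since otherwise a limit of rescaled orbit segments would give a backward
    orbit that is not in \<open>E\<close>.  Summing up the errors yields \<open>X = E + Z\<close> (\<open>decomposition\<close>).

  \<^item> It remains to study orbits in the finite-dimensional \<open>E\<close>, where \<open>T\<close> is injective and shrinks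
    vectors at most subexponentially, so that no nonzero vector decays even along a subsequence
    (\<open>no_vanishing_times\<close>).  From this, \<open>T ^ n\<close> is uniformly bounded below at any set of times, on
    those vectors of \<open>E\<close> whose orbit is bounded at these times (\<open>lower_bound_at_bounded_times\<close>).  This gives the lower bound for bounded
    orbits.  It also shows that an orbit which returns to a ball infinitely often
    returns with bounded gaps, and hence is bounded (\<open>bounded_if_recurrently_bounded\<close>).\<close>

section \<open>Finite-dimensional subspaces of normed spaces\<close>

lemma norm_sum_le_coordinates:
  fixes f :: "'a::real_normed_vector \<Rightarrow> 'b::real_normed_vector"
  assumes "linear f" and "\<And>b. b \<in> B \<Longrightarrow> norm (f b) \<le> C"
  shows "norm (f (\<Sum>b\<in>B. c b *\<^sub>R b)) \<le> (\<Sum>b\<in>B. \<bar>c b\<bar>) * C"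
proof -
  have "f (\<Sum>b\<in>B. c b *\<^sub>R b) = (\<Sum>b\<in>B. c b *\<^sub>R f b)"
    using assms(1) by (simp add: linear_sum linear_cmul)
  also have "norm \<dots> \<le> (\<Sum>b\<in>B. \<bar>c b\<bar> * C)"
    by (rule sum_norm_le) (use assms(2) in \<open>auto intro: mult_left_mono\<close>)
  finally show ?thesis by (simp add: sum_distrib_right)
qed

definition coordinates_bounded :: "'a::real_normed_vector set \<Rightarrow> real \<Rightarrow> bool"
  where "coordinates_bounded B K \<longleftrightarrow>
    K > 0 \<and> (\<forall>c. (\<Sum>b\<in>B. \<bar>c b\<bar>) \<le> K * norm (\<Sum>b\<in>B. c b *\<^sub>R b))"

lemma coordinates_boundedD:
  assumes "coordinates_bounded B K"
  shows "K > 0" and "(\<Sum>b\<in>B. \<bar>c b\<bar>) \<le> K * norm (\<Sum>b\<in>B. c b *\<^sub>R b)"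
  using assms by (simp_all add: coordinates_bounded_def)

text \<open>A bound on the coordinates turns a convergent sequence of vectors into Cauchy sequences of
  coordinates, whose limits are the coordinates of the limit.\<close>

lemma closed_span_if_coordinates_bounded:
  fixes B :: "'a::real_normed_vector set"
  assumes "finite B" and K: "coordinates_bounded B K"
  shows "closed (span B)"
  unfolding closed_sequential_limits
proof (intro allI impI, elim conjE)
  fix x :: "nat \<Rightarrow> 'a" and l
  assume x: "\<forall>n. x n \<in> span B" and l: "x \<longlonglongrightarrow> l"
  have "\<forall>n. \<exists>c. x n = (\<Sum>b\<in>B. c b *\<^sub>R b)"
    using x span_finite[OF \<open>finite B\<close>] by auto
  then obtain c where c: "\<And>n. x n = (\<Sum>b\<in>B. c n b *\<^sub>R b)" by metis
  have K0: "K > 0" using K by (simp add: coordinates_bounded_def)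
  have diff: "\<bar>c m b - c n b\<bar> \<le> K * norm (x m - x n)" if "b \<in> B" for b m n
  proof -
    have "\<bar>c m b - c n b\<bar> \<le> (\<Sum>b\<in>B. \<bar>c m b - c n b\<bar>)"
      using that \<open>finite B\<close> by (intro member_le_sum) auto
    also have "\<dots> \<le> K * norm (\<Sum>b\<in>B. (c m b - c n b) *\<^sub>R b)"
      by (rule coordinates_boundedD(2)[OF K])
    also have "(\<Sum>b\<in>B. (c m b - c n b) *\<^sub>R b) = x m - x n"
      by (simp add: c scaleR_diff_left sum_subtractf)
    finally show ?thesis .
  qed
  have "Cauchy (\<lambda>n. c n b)" if "b \<in> B" for b
  proof (rule metric_CauchyI)
    fix e :: real assume "e > 0"
    have "Cauchy x" using l LIMSEQ_imp_Cauchy by blast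
    then obtain M where M: "\<And>m n. m \<ge> M \<Longrightarrow> n \<ge> M \<Longrightarrow> dist (x m) (x n) < e / K"
      using \<open>e > 0\<close> K0 metric_CauchyD[of x "e / K"] by (metis divide_pos_pos)
    show "\<exists>M. \<forall>m\<ge>M. \<forall>n\<ge>M. dist (c m b) (c n b) < e"
    proof (intro exI allI impI)
      fix m n assume "m \<ge> M" "n \<ge> M"
      then have "K * norm (x m - x n) < e"
        using M K0 by (simp add: dist_norm field_simps)
      then show "dist (c m b) (c n b) < e"
        using diff[OF that, of m n] by (simp add: dist_real_def)
    qed
  qed
  then have "\<forall>b\<in>B. \<exists>d. (\<lambda>n. c n b) \<longlonglongrightarrow> d"
    by (simp add: Cauchy_convergent_iff convergent_def)
  then obtain d where "\<And>b. b \<in> B \<Longrightarrow> (\<lambda>n. c n b) \<longlonglongrightarrow> d b" by metis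
  then have "x \<longlonglongrightarrow> (\<Sum>b\<in>B. d b *\<^sub>R b)"
    unfolding c by (intro tendsto_sum tendsto_scaleR tendsto_const)
  then have "l = (\<Sum>b\<in>B. d b *\<^sub>R b)" using l LIMSEQ_unique by blast
  then show "l \<in> span B"
    by (simp add: span_base span_scale span_sum)
qed

text \<open>Induction on \<open>B\<close>: as the span of \<open>B\<close> is closed by the induction hypothesis, a new vector \<open>a\<close> has
  positive distance \<open>d\<close> from it, which bounds the coefficient of \<open>a\<close>, and the other coefficients are
  then bounded through \<open>B\<close>.\<close>

lemma independent_imp_coordinates_bounded:
  fixes B :: "'a::real_normed_vector set"
  assumes "finite B" "independent B"
  shows "\<exists>K. coordinates_bounded B K"
  using assms
proof (induction B rule: finite_induct)
  case empty
  show ?case by (intro exI[of _ 1]) (simp add: coordinates_bounded_def)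
next
  case (insert a B)
  then have a: "a \<notin> span B" and "independent B" by (auto simp: independent_insert)
  then obtain K where K: "coordinates_bounded B K" using insert by blast
  have K0: "K > 0" and Kc: "\<And>c. (\<Sum>b\<in>B. \<bar>c b\<bar>) \<le> K * norm (\<Sum>b\<in>B. c b *\<^sub>R b)"
    using K by (auto simp: coordinates_bounded_def)
  define d where "d = infdist a (span B)"
  have d: "d > 0"
    unfolding d_def using closed_span_if_coordinates_bounded[OF insert(1) K] a
    by (intro infdist_pos_not_in_closed) (auto intro: span_zero)
  have ca: "\<bar>t\<bar> * d \<le> norm (t *\<^sub>R a + y)" if "y \<in> span B" for t y
  proof (cases "t = 0")
    case False
    have "d \<le> dist a (- (1 / t) *\<^sub>R y)"
      unfolding d_def by (intro infdist_le span_scale that)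
    then have "\<bar>t\<bar> * d \<le> norm (t *\<^sub>R (a + (1 / t) *\<^sub>R y))"
      by (simp add: dist_norm mult_left_mono)
    then show ?thesis using False by (simp add: scaleR_add_right)
  qed simp
  define L where "L = 1 / d + K * (1 + norm a / d)"
  have "(\<Sum>b\<in>insert a B. \<bar>c b\<bar>) \<le> L * norm (\<Sum>b\<in>insert a B. c b *\<^sub>R b)" for c
  proof -
    let ?y = "\<Sum>b\<in>B. c b *\<^sub>R b" and ?s = "\<Sum>b\<in>insert a B. c b *\<^sub>R b"
    have s: "?s = c a *\<^sub>R a + ?y" using insert by simp
    have "\<bar>c a\<bar> * d \<le> norm ?s"
      unfolding s by (intro ca span_sum span_scale span_base)
    then have 1: "\<bar>c a\<bar> \<le> norm ?s / d" using d by (simp add: field_simps)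
    have "norm ?y = norm (?s - c a *\<^sub>R a)" by (simp add: s)
    also have "\<dots> \<le> norm ?s + \<bar>c a\<bar> * norm a"
      by (metis norm_scaleR norm_triangle_ineq4)
    also have "\<dots> \<le> norm ?s + norm ?s / d * norm a"
      using 1 by (intro add_left_mono mult_right_mono) auto
    finally have "norm ?y \<le> norm ?s * (1 + norm a / d)" by (simp add: algebra_simps)
    then have "K * norm ?y \<le> K * (norm ?s * (1 + norm a / d))"
      using K0 by (intro mult_left_mono) auto
    then have "(\<Sum>b\<in>B. \<bar>c b\<bar>) \<le> K * (norm ?s * (1 + norm a / d))"
      using Kc[of c] by linarith
    then show ?thesis
      using 1 insert by (simp add: L_def algebra_simps)
  qed
  moreover have "L > 0" using d K0 unfolding L_def
    by (intro add_pos_pos mult_pos_pos add_pos_nonneg divide_pos_pos) auto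
  ultimately show ?case unfolding coordinates_bounded_def by blast
qed

lemma closed_span_finite:
  fixes B :: "'a::real_normed_vector set"
  assumes "finite B"
  shows "closed (span B)"
proof -
  obtain A where "A \<subseteq> B" "independent A" "B \<subseteq> span A"
    using maximal_independent_subset by blast
  moreover from this have "span A = span B"
    by (metis span_mono span_span subset_antisym)
  ultimately show ?thesis
    by (metis assms closed_span_if_coordinates_bounded finite_subset
        independent_imp_coordinates_bounded)
qed

lemma subspace_of_span_finite:
  fixes F :: "'a::real_vector set"
  assumes "finite B" "subspace F" "F \<subseteq> span B"
  obtains A where "finite A" "independent A" "F = span A"
proof -
  obtain A where A: "A \<subseteq> F" "independent A" "F \<subseteq> span A"
    using maximal_independent_subset by blast
  then have "F = span A" using assms(2) span_minimal by blast
  moreover have "finite A"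
    using independent_span_bound[OF assms(1) A(2)] A(1) assms(3) by blast
  ultimately show ?thesis using that A by blast
qed

text \<open>The constant \<open>K\<close> is chosen before the map \<open>f\<close> and the bound \<open>C\<close>.  So pointwise boundedness, or
  pointwise smallness, of a family of linear maps on a finite-dimensional space is uniform.\<close>

lemma linear_bound_from_basis:
  fixes B :: "'a::real_normed_vector set"
  assumes "finite B" "independent B"
  shows "\<exists>K>0. \<forall>(f :: 'a \<Rightarrow> 'b::real_normed_vector) C. linear f \<longrightarrow> 0 \<le> C \<longrightarrow>
    (\<forall>b\<in>B. norm (f b) \<le> C) \<longrightarrow> (\<forall>v\<in>span B. norm (f v) \<le> K * C * norm v)"
proof -
  obtain K where K: "coordinates_bounded B K"
    using independent_imp_coordinates_bounded assms by blast
  show ?thesis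
  proof (intro exI[of _ K] conjI allI impI ballI)
    show "K > 0" by (rule coordinates_boundedD(1)[OF K])
    fix f :: "'a \<Rightarrow> 'b" and C v
    assume f: "linear f" "0 \<le> C" "\<forall>b\<in>B. norm (f b) \<le> C" and "v \<in> span B"
    then obtain c where v: "v = (\<Sum>b\<in>B. c b *\<^sub>R b)"
      using span_finite[OF assms(1)] by auto
    have "norm (f v) \<le> (\<Sum>b\<in>B. \<bar>c b\<bar>) * C"
      unfolding v by (rule norm_sum_le_coordinates[OF f(1)]) (use f(3) in blast)
    also have "\<dots> \<le> (K * norm v) * C"
      unfolding v by (intro mult_right_mono coordinates_boundedD(2)[OF K] f(2))
    finally show "norm (f v) \<le> K * C * norm v" by (simp add: mult_ac)
  qed
qed

section \<open>Auxiliary facts on sequences and distances\<close>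

text \<open>Compactness of a countable product of compact sets, in place of a diagonal argument.\<close>

lemma convergent_subsequence_of_coordinates:
  fixes k :: "nat \<Rightarrow> nat \<Rightarrow> 'a::metric_space"
  assumes "\<And>j. compact (K j)" and "\<And>n j. k n j \<in> K j"
  obtains l \<phi> where "strict_mono (\<phi> :: nat \<Rightarrow> nat)" and "\<And>j. (\<lambda>n. k (\<phi> n) j) \<longlonglongrightarrow> l j"
proof -
  have "compactin (product_topology (\<lambda>j. euclidean) UNIV) (PiE UNIV K)"
    using assms(1) by (auto simp: compactin_PiE compactin_euclidean_iff)
  then have "compact (PiE UNIV K)"
    by (simp add: euclidean_product_topology compactin_euclidean_iff)
  moreover have "\<forall>n. k n \<in> PiE UNIV K" using assms(2) by auto
  ultimately obtain l \<phi> where \<phi>: "strict_mono \<phi>" and l: "(k \<circ> \<phi>) \<longlonglongrightarrow> l"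
    unfolding compact_eq_seq_compact_metric seq_compact_def by blast
  have "(\<lambda>n. k (\<phi> n) j) \<longlonglongrightarrow> l j" for j
  proof -
    have "continuous_on UNIV (\<lambda>f :: nat \<Rightarrow> 'a. f j)" by simp
    then have "(\<lambda>n. (k \<circ> \<phi>) n j) \<longlonglongrightarrow> l j"
      using l by (rule continuous_on_tendsto_compose) auto
    then show ?thesis by simp
  qed
  with \<phi> that show ?thesis by blast
qed

lemma exists_nearly_nearest_point:
  assumes "closed E" "E \<noteq> {}"
  obtains p where "p \<in> E" "dist y p \<le> 2 * infdist y E"
proof (cases "infdist y E = 0")
  case True
  then have "y \<in> E" using assms in_closed_iff_infdist_zero by blast
  then show ?thesis using that[of y] True by simp
next
  case False
  then have "infdist y E < 2 * infdist y E" using infdist_nonneg[of y E] by linarith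
  then obtain p where "p \<in> E" "dist y p < 2 * infdist y E"
    using assms(2) unfolding infdist_notempty[OF assms(2)]
    by (subst (asm) cINF_less_iff) auto
  then show ?thesis using that by force
qed

text \<open>A record time \<open>n\<close> is one at which \<open>b\<close> is at least as large as at any time before.  The first time
  at which \<open>b\<close> exceeds \<open>0\<close> and its values up to \<open>N\<close> is one.\<close>

lemma unbounded_has_records:
  fixes b :: "nat \<Rightarrow> real"
  assumes "\<And>C. \<exists>n. C < b n"
  shows "\<exists>n\<ge>N. 0 < b n \<and> (\<forall>m\<le>n. b m \<le> b n)"
proof -
  define C where "C = Max (insert 0 (b ` {..N}))"
  define n where "n = (LEAST n. C < b n)"
  have n: "C < b n" unfolding n_def using assms by (rule LeastI_ex)
  have "b m \<le> C" if "m < n" for m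
    using not_less_Least[of m "\<lambda>n. C < b n"] that unfolding n_def by simp
  then have "\<forall>m\<le>n. b m \<le> b n" using n by (metis le_less order.strict_trans1 less_imp_le order_refl)
  moreover have "b m \<le> C" if "m \<le> N" for m
    unfolding C_def using that by (intro Max_ge) auto
  then have "N \<le> n" using n by (meson not_less leD nat_le_linear)
  moreover have "0 \<le> C" unfolding C_def by (intro Max_ge) auto
  ultimately show ?thesis using n by force
qed

lemma geometric_convolution_bound:
  fixes r s :: real
  assumes "0 \<le> s" "s < r"
  shows "(\<Sum>i<n. r ^ i * s ^ (n - i)) \<le> s / (r - s) * r ^ n"
proof (induction n)
  case 0
  show ?case using assms by simp
next
  case (Suc n)
  have "(\<Sum>i<n. r ^ i * s ^ (Suc n - i)) = s * (\<Sum>i<n. r ^ i * s ^ (n - i))"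
    unfolding sum_distrib_left by (intro sum.cong) (auto simp: Suc_diff_le)
  then have "(\<Sum>i<Suc n. r ^ i * s ^ (Suc n - i)) = s * (\<Sum>i<n. r ^ i * s ^ (n - i)) + r ^ n * s"
    by simp
  also have "\<dots> \<le> s * (s / (r - s) * r ^ n) + r ^ n * s"
    using Suc assms by (intro add_right_mono mult_left_mono) auto
  also have "\<dots> = s / (r - s) * r ^ Suc n"
    using assms by (simp add: field_simps)
  finally show ?case .
qed

section \<open>Backward orbits\<close>

locale compact_endomorphism =
  fixes T :: "'a::banach \<Rightarrow> 'a"
  assumes linear_T: "linear T"
    and compact_image: "\<And>S. bounded S \<Longrightarrow> compact (closure (T ` S))"
begin

lemma linear_pow: "linear (T ^^ n)"
proof (induction n)
  case 0
  show ?case by (simp add: linear_iff)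
next
  case (Suc n)
  then show ?case using linear_compose[OF Suc linear_T] by (simp add: o_def)
qed

lemma bounded_linear_T: "bounded_linear T"
proof -
  have "bounded (T ` cball 0 1)"
    using compact_image[OF bounded_cball[of 0 1]] compact_imp_bounded bounded_subset closure_subset
    by blast
  then obtain L where L: "\<And>x. norm x \<le> 1 \<Longrightarrow> norm (T x) \<le> L"
    unfolding bounded_iff by (metis image_eqI mem_cball_0)
  have "norm (T x) \<le> norm x * L" for x
  proof (cases "x = 0")
    case False
    have "T x = norm x *\<^sub>R T ((1 / norm x) *\<^sub>R x)"
      using False by (simp add: linear_cmul[OF linear_T])
    moreover have "norm (T ((1 / norm x) *\<^sub>R x)) \<le> L"
      using False by (intro L) simp
    ultimately show ?thesis using mult_left_mono[OF _ norm_ge_zero[of x]] by simp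
  qed (simp add: linear_0[OF linear_T])
  then show ?thesis
    using linear_T by (intro bounded_linear.intro bounded_linear_axioms.intro) auto
qed

lemma norm_T_le: obtains L where "L \<ge> 1" and "\<And>x. norm (T x) \<le> L * norm x"
proof -
  obtain L where L: "\<And>x. norm (T x) \<le> norm x * L"
    using bounded_linear.bounded[OF bounded_linear_T] by blast
  have "norm (T x) \<le> max 1 L * norm x" for x
  proof -
    have "norm x * L \<le> norm x * max 1 L" by (intro mult_left_mono) auto
    then show ?thesis using L[of x] by (simp add: mult.commute)
  qed
  then show ?thesis using that[of "max 1 L"] by simp
qed

lemma tendsto_T: "(f \<longlongrightarrow> l) F \<Longrightarrow> ((\<lambda>x. T (f x)) \<longlongrightarrow> T l) F"
  by (rule bounded_linear.tendsto[OF bounded_linear_T])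

lemma tendsto_pow: "(f \<longlongrightarrow> l) F \<Longrightarrow> ((\<lambda>x. (T ^^ n) (f x)) \<longlongrightarrow> (T ^^ n) l) F"
  by (induction n) (auto intro: tendsto_T)

definition backward_orbit :: "real \<Rightarrow> real \<Rightarrow> (nat \<Rightarrow> 'a) \<Rightarrow> bool"
  where "backward_orbit r C u \<longleftrightarrow> (\<forall>n. T (u (Suc n)) = u n \<and> norm (u n) \<le> C * r ^ n)"

text \<open>A vector may have several backward orbits, and the constant depends on the orbit.  Only the
  growth rate is prescribed.\<close>

definition backward_space :: "real \<Rightarrow> 'a set"
  where "backward_space r = {u 0 | u. \<exists>C. backward_orbit r C u}"

lemma backward_spaceI: "backward_orbit r C u \<Longrightarrow> u 0 = x \<Longrightarrow> x \<in> backward_space r"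
  unfolding backward_space_def by auto

lemma backward_spaceE:
  assumes "x \<in> backward_space r"
  obtains u C where "backward_orbit r C u" "u 0 = x"
  using assms unfolding backward_space_def by auto

lemma backward_orbit_pow: "backward_orbit r C u \<Longrightarrow> (T ^^ n) (u (n + k)) = u k"
  by (induction n) (auto simp: backward_orbit_def funpow_swap1)

lemma backward_orbit_bound_nonneg: "backward_orbit r C u \<Longrightarrow> 0 \<le> C"
  unfolding backward_orbit_def by (metis norm_ge_zero mult.right_neutral order_trans power_0)

lemma backward_orbit_shift:
  assumes "backward_orbit r C u"
  shows "backward_orbit r (C * r ^ k) (\<lambda>n. u (n + k))"
  unfolding backward_orbit_def
proof
  fix n
  have "norm (u (n + k)) \<le> C * r ^ (n + k)"
    using assms by (simp add: backward_orbit_def)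
  then show "T (u (Suc n + k)) = u (n + k) \<and> norm (u (n + k)) \<le> C * r ^ k * r ^ n"
    using assms by (simp add: backward_orbit_def power_add mult_ac)
qed

lemma backward_orbit_in_backward_space:
  assumes "backward_orbit r C u" shows "u n \<in> backward_space r"
  using backward_spaceI[OF backward_orbit_shift[OF assms, of n]] by simp

lemma backward_orbit_sum:
  assumes "finite B" and "\<And>b. b \<in> B \<Longrightarrow> backward_orbit r (C b) (u b)"
  shows "backward_orbit r (\<Sum>b\<in>B. \<bar>c b\<bar> * C b) (\<lambda>n. \<Sum>b\<in>B. c b *\<^sub>R u b n)"
  unfolding backward_orbit_def
proof
  fix n
  have "norm (\<Sum>b\<in>B. c b *\<^sub>R u b n) \<le> (\<Sum>b\<in>B. \<bar>c b\<bar> * (C b * r ^ n))"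
    by (rule sum_norm_le) (use assms(2) in \<open>auto simp: backward_orbit_def intro: mult_left_mono\<close>)
  also have "\<dots> = (\<Sum>b\<in>B. \<bar>c b\<bar> * C b) * r ^ n" by (simp add: sum_distrib_right mult.assoc)
  finally show "T (\<Sum>b\<in>B. c b *\<^sub>R u b (Suc n)) = (\<Sum>b\<in>B. c b *\<^sub>R u b n) \<and>
      norm (\<Sum>b\<in>B. c b *\<^sub>R u b n) \<le> (\<Sum>b\<in>B. \<bar>c b\<bar> * C b) * r ^ n"
    using assms(2)
    by (simp add: linear_sum[OF linear_T] linear_cmul[OF linear_T] backward_orbit_def)
qed

lemma subspace_backward_space: "subspace (backward_space r)"
proof (rule subspaceI)
  have "backward_orbit r 0 (\<lambda>n. 0)"
    by (simp add: backward_orbit_def linear_0[OF linear_T])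
  then show "0 \<in> backward_space r" by (auto simp: backward_space_def)
next
  fix x y assume "x \<in> backward_space r" "y \<in> backward_space r"
  then obtain u v C D where "backward_orbit r C u" "u 0 = x" "backward_orbit r D v" "v 0 = y"
    by (elim backward_spaceE)
  moreover from this have *: "backward_orbit r (C + D) (\<lambda>n. u n + v n)"
    by (auto simp: backward_orbit_def linear_add[OF linear_T] distrib_right
        intro: norm_triangle_mono)
  ultimately show "x + y \<in> backward_space r" by (intro backward_spaceI[OF *]) simp
next
  fix t x assume "x \<in> backward_space r"
  then obtain u C where u: "backward_orbit r C u" "u 0 = x"
    by (elim backward_spaceE)
  then have "backward_orbit r (\<bar>t\<bar> * C) (\<lambda>n. t *\<^sub>R u n)"
    by (auto simp: backward_orbit_def linear_cmul[OF linear_T] mult.assoc intro: mult_left_mono)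
  then show "t *\<^sub>R x \<in> backward_space r" by (rule backward_spaceI) (simp add: u(2))
qed

lemma backward_space_mono:
  assumes "0 < r" "r \<le> s" shows "backward_space r \<subseteq> backward_space s"
proof
  fix x assume "x \<in> backward_space r"
  then obtain u C where u: "backward_orbit r C u" "u 0 = x"
    by (elim backward_spaceE)
  have "norm (u n) \<le> C * s ^ n" for n
  proof -
    have "C * r ^ n \<le> C * s ^ n"
      using assms backward_orbit_bound_nonneg[OF u(1)] by (intro mult_left_mono power_mono) auto
    then show ?thesis using u(1) unfolding backward_orbit_def by (meson order_trans)
  qed
  then have "backward_orbit s C u" using u(1) by (simp add: backward_orbit_def)
  then show "x \<in> backward_space s" using u(2) by (rule backward_spaceI)
qed

text \<open>Each of the balls that cover the \<open>n\<close>-th image is mapped by \<open>T\<close> to a translated and rescaled copy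
  of the image of the unit ball, which is covered by \<open>card Y\<close> balls.\<close>

lemma iterated_covering:
  assumes "finite Y" and cover: "T ` cball 0 1 \<subseteq> (\<Union>y\<in>Y. cball y e)" and "e > 0" "R > 0"
  shows "\<exists>A. finite A \<and> card A \<le> card Y ^ n \<and>
    (T ^^ n) ` cball 0 R \<subseteq> (\<Union>a\<in>A. cball a (e ^ n * R))"
proof (induction n)
  case 0
  show ?case by (intro exI[of _ "{0}"]) auto
next
  case (Suc n)
  then obtain A where A: "finite A" "card A \<le> card Y ^ n"
    "(T ^^ n) ` cball 0 R \<subseteq> (\<Union>a\<in>A. cball a (e ^ n * R))" by blast
  define q where "q = e ^ n * R"
  have q: "q > 0" using assms by (simp add: q_def)
  define A' where "A' = (\<lambda>(a, y). T a + q *\<^sub>R y) ` (A \<times> Y)"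
  have "card A' \<le> card A * card Y"
    unfolding A'_def using A(1) assms(1) card_image_le[of "A \<times> Y"] by (simp add: card_cartesian_product)
  also have "\<dots> \<le> card Y ^ Suc n" using A(2) by simp
  finally have "card A' \<le> card Y ^ Suc n" .
  moreover have "finite A'" using A(1) assms(1) by (simp add: A'_def)
  moreover have "(T ^^ Suc n) ` cball 0 R \<subseteq> (\<Union>a\<in>A'. cball a (e ^ Suc n * R))"
  proof
    fix z assume "z \<in> (T ^^ Suc n) ` cball 0 R"
    then obtain x where x: "x \<in> (T ^^ n) ` cball 0 R" "z = T x" by auto
    then have "x \<in> (\<Union>a\<in>A. cball a q)" using A(3) unfolding q_def by blast
    then obtain a where a: "a \<in> A" "norm (x - a) \<le> q"
      by (auto simp: dist_norm norm_minus_commute)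
    have "T ((1 / q) *\<^sub>R (x - a)) \<in> T ` cball 0 1"
      using a q by (intro imageI) (simp add: divide_simps)
    then have "T ((1 / q) *\<^sub>R (x - a)) \<in> (\<Union>y\<in>Y. cball y e)" using cover by blast
    then obtain y where y: "y \<in> Y" "norm (T ((1 / q) *\<^sub>R (x - a)) - y) \<le> e"
      by (auto simp: dist_norm norm_minus_commute)
    have "z - (T a + q *\<^sub>R y) = q *\<^sub>R (T ((1 / q) *\<^sub>R (x - a)) - y)"
      using q x by (simp add: linear_cmul[OF linear_T] linear_diff[OF linear_T] algebra_simps)
    then have "norm (z - (T a + q *\<^sub>R y)) \<le> q * e"
      using y(2) q by (simp add: mult_left_mono)
    then have "z \<in> cball (T a + q *\<^sub>R y) (e ^ Suc n * R)"
      by (simp add: dist_norm norm_minus_commute q_def mult_ac)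
    moreover have "T a + q *\<^sub>R y \<in> A'" using a(1) y(1) by (auto simp: A'_def)
    ultimately show "z \<in> (\<Union>a\<in>A'. cball a (e ^ Suc n * R))" by blast
  qed
  ultimately show ?case by blast
qed

text \<open>The idea is to compare two exponential rates.  Combinations of \<open>B\<close> with coefficients in
  \<open>{0..<2 ^ m}\<close> are separated by a distance independent of \<open>m\<close>.  Following their backward orbits for
  \<open>m\<close> steps, they lie in the \<open>m\<close>-th image of a ball of radius \<open>O((2 * r) ^ m)\<close>, so they are within
  \<open>O((1 / 2) ^ m)\<close> of at most \<open>card Y ^ m\<close> centres.  For large \<open>m\<close> different combinations have
  different centres.\<close>

lemma card_independent_backward_space:
  assumes B: "finite B" "independent B" "B \<subseteq> backward_space r" and "r > 0"
    and Y: "finite Y" "T ` cball 0 1 \<subseteq> (\<Union>y\<in>Y. cball y (1 / (4 * r)))"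
  shows "2 ^ card B \<le> card Y"
proof -
  have "\<forall>b\<in>B. \<exists>u C. backward_orbit r C u \<and> u 0 = b"
    using B(3) backward_spaceE by (metis subsetD)
  then obtain u C where u: "\<And>b. b \<in> B \<Longrightarrow> backward_orbit r (C b) (u b)"
    and u0: "\<And>b. b \<in> B \<Longrightarrow> u b 0 = b" by metis
  obtain K where K: "coordinates_bounded B K"
    using independent_imp_coordinates_bounded B by blast
  define D where "D = (\<Sum>b\<in>B. C b) + 1"
  have D: "D > 0" using backward_orbit_bound_nonneg[OF u] unfolding D_def
    by (intro add_nonneg_pos sum_nonneg) auto
  have "1 / (2 * D * K) > 0" using D coordinates_boundedD(1)[OF K] by simp
  then obtain n :: nat where n: "(1 / 2) ^ n < 1 / (2 * D * K)"
    using real_arch_pow_inv[of "1 / (2 * D * K)" "1 / 2"] by auto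
  define m where "m = Suc n"
  have "(1 / 2 :: real) ^ m \<le> (1 / 2) ^ n" by (simp add: m_def)
  from le_less_trans[OF this n] have "2 * D * (1 / 2) ^ m < 2 * D * (1 / (2 * D * K))"
    using D by (intro mult_strict_left_mono) auto
  then have m: "2 * ((1 / 2) ^ m * D) < 1 / K"
    using D by (simp add: mult_ac)
  define R where "R = 2 ^ m * D * r ^ m"
  have R: "R > 0" using D \<open>r > 0\<close> by (simp add: R_def)
  obtain A where A: "finite A" "card A \<le> card Y ^ m"
    "(T ^^ m) ` cball 0 R \<subseteq> (\<Union>a\<in>A. cball a ((1 / (4 * r)) ^ m * R))"
    using iterated_covering[OF Y _ R, of m] \<open>r > 0\<close> by auto
  have "(1 / (4 * r)) ^ m * R = (1 / (4 * r) * 2 * r) ^ m * D"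
    unfolding R_def power_mult_distrib by simp
  also have "1 / (4 * r) * 2 * r = 1 / 2" using \<open>r > 0\<close> by simp
  finally have radius: "(1 / (4 * r)) ^ m * R = (1 / 2) ^ m * D" .
  \<comment> \<open>The points of the grid are indexed by their coefficients; for large \<open>m\<close> the choice \<open>f\<close> of a nearby
    centre is injective.\<close>
  define G where "G = (B \<rightarrow>\<^sub>E {..<(2::nat) ^ m})"
  define p where "p g = (\<Sum>b\<in>B. real (g b) *\<^sub>R b)" for g :: "'a \<Rightarrow> nat"
  have in_ball: "p g \<in> (T ^^ m) ` cball 0 R" if "g \<in> G" for g
  proof -
    let ?v = "\<lambda>n. \<Sum>b\<in>B. real (g b) *\<^sub>R u b n"
    have v: "backward_orbit r (\<Sum>b\<in>B. \<bar>real (g b)\<bar> * C b) ?v"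
      by (rule backward_orbit_sum[OF B(1) u])
    have "?v 0 = p g" by (simp add: p_def u0)
    then have "p g = (T ^^ m) (?v m)" using backward_orbit_pow[OF v, of m 0] by simp
    moreover have "norm (?v m) \<le> R"
    proof -
      have "(\<Sum>b\<in>B. \<bar>real (g b)\<bar> * C b) \<le> (\<Sum>b\<in>B. 2 ^ m * C b)"
      proof (intro sum_mono mult_right_mono)
        fix b assume b: "b \<in> B"
        then have "g b < 2 ^ m" using that by (auto simp: G_def)
        then show "\<bar>real (g b)\<bar> \<le> 2 ^ m" by (simp flip: of_nat_le_iff)
        show "0 \<le> C b" using backward_orbit_bound_nonneg[OF u[OF b]] .
      qed
      also have "\<dots> \<le> 2 ^ m * D" by (simp add: D_def flip: sum_distrib_left)
      finally have "(\<Sum>b\<in>B. \<bar>real (g b)\<bar> * C b) * r ^ m \<le> R"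
        unfolding R_def using \<open>r > 0\<close> by (intro mult_right_mono) auto
      then show ?thesis using v unfolding backward_orbit_def by (meson order_trans)
    qed
    ultimately show ?thesis by auto
  qed
  have "\<forall>g\<in>G. \<exists>a\<in>A. dist a (p g) \<le> (1 / 2) ^ m * D"
  proof
    fix g assume "g \<in> G"
    then have "p g \<in> (\<Union>a\<in>A. cball a ((1 / 2) ^ m * D))"
      by (intro subsetD[OF A(3)[unfolded radius]] in_ball)
    then show "\<exists>a\<in>A. dist a (p g) \<le> (1 / 2) ^ m * D" by (simp only: UN_iff mem_cball)
  qed
  then obtain f where f: "\<And>g. g \<in> G \<Longrightarrow> f g \<in> A"
    "\<And>g. g \<in> G \<Longrightarrow> dist (f g) (p g) \<le> (1 / 2) ^ m * D" by metis
  have "inj_on f G"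
  proof (rule inj_onI, rule ccontr)
    fix g h assume g: "g \<in> G" and h: "h \<in> G" and "f g = f h" "g \<noteq> h"
    then obtain b where b: "b \<in> B" "g b \<noteq> h b"
      unfolding G_def by (metis PiE_ext)
    have "1 \<le> \<bar>real (g b) - real (h b)\<bar>" using b(2) by linarith
    also have "\<dots> \<le> (\<Sum>b\<in>B. \<bar>real (g b) - real (h b)\<bar>)"
      using b(1) B(1) by (intro member_le_sum) auto
    also have "\<dots> \<le> K * norm (\<Sum>b\<in>B. (real (g b) - real (h b)) *\<^sub>R b)"
      by (rule coordinates_boundedD(2)[OF K])
    also have "(\<Sum>b\<in>B. (real (g b) - real (h b)) *\<^sub>R b) = p g - p h"
      by (simp add: p_def scaleR_diff_left sum_subtractf)
    finally have "1 / K \<le> dist (p g) (p h)"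
      using coordinates_boundedD(1)[OF K] by (simp add: dist_norm field_simps)
    moreover have "dist (p g) (p h) \<le> dist (f g) (p g) + dist (f h) (p h)"
      using \<open>f g = f h\<close> dist_triangle3 by metis
    ultimately show False using f(2)[OF g] f(2)[OF h] m by linarith
  qed
  then have "card G \<le> card A"
    using f(1) A(1) by (intro card_inj_on_le[of f]) auto
  then have "(2 ^ m) ^ card B \<le> card Y ^ m"
    using A(2) B(1) by (simp add: G_def card_PiE)
  moreover have "((2 :: nat) ^ m) ^ card B = (2 ^ card B) ^ m"
    by (metis mult.commute power_mult)
  ultimately have "(2 ^ card B) ^ Suc n \<le> card Y ^ Suc n" by (simp only: m_def)
  then show ?thesis by (rule power_le_imp_le_base) simp
qed

lemma backward_space_finite_basis:
  assumes "r > 0"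
  obtains B where "finite B" "independent B" "backward_space r = span B"
proof -
  have "compact (closure (T ` cball 0 1))" by (simp add: compact_image)
  then have "\<forall>e>0. \<exists>Y. finite Y \<and> closure (T ` cball 0 1) \<subseteq> (\<Union>y\<in>Y. ball y e)"
    unfolding compact_eq_totally_bounded by simp
  moreover have "1 / (4 * r) > 0" using assms by simp
  ultimately obtain Y where Y: "finite Y" "closure (T ` cball 0 1) \<subseteq> (\<Union>y\<in>Y. ball y (1 / (4 * r)))"
    by meson
  have "T ` cball 0 1 \<subseteq> closure (T ` cball 0 1)" by (rule closure_subset)
  also have "\<dots> \<subseteq> (\<Union>y\<in>Y. ball y (1 / (4 * r)))" by (rule Y(2))
  also have "\<dots> \<subseteq> (\<Union>y\<in>Y. cball y (1 / (4 * r)))" by (intro UN_mono ball_subset_cball subset_refl)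
  finally have "T ` cball 0 1 \<subseteq> (\<Union>y\<in>Y. cball y (1 / (4 * r)))" .
  note bound = card_independent_backward_space[OF _ _ _ assms Y(1) this]
  obtain B where B: "B \<subseteq> backward_space r" "independent B" "backward_space r \<subseteq> span B"
    using maximal_independent_subset by blast
  have "finite B"
  proof (rule ccontr)
    assume "infinite B"
    then obtain A where A: "finite A" "card A = card Y" "A \<subseteq> B"
      using infinite_arbitrarily_large by blast
    then have "2 ^ card A \<le> card Y"
      using B by (intro bound independent_mono[OF B(2)]) auto
    then have "2 ^ card Y \<le> card Y" by (simp add: A(2))
    then show False using less_exp[of "card Y"] by linarith
  qed
  moreover have "backward_space r = span B"
    using B subspace_backward_space span_minimal by blast
  ultimately show ?thesis using that B(2) by blast
qed

lemma backward_orbit_weaken: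
  assumes "backward_orbit r C u" "C \<le> D" "0 \<le> r"
  shows "backward_orbit r D u"
proof -
  have "norm (u n) \<le> D * r ^ n" for n
  proof -
    have "C * r ^ n \<le> D * r ^ n" using assms(2,3) by (intro mult_right_mono) auto
    then show ?thesis using assms(1) unfolding backward_orbit_def by (meson order_trans)
  qed
  then show ?thesis using assms(1) by (simp add: backward_orbit_def)
qed

lemma T_in_backward_space: "x \<in> backward_space r \<Longrightarrow> T x \<in> backward_space r"
proof (elim backward_spaceE)
  fix u C assume u: "backward_orbit r C u" "u 0 = x"
  obtain L where L: "L \<ge> 1" "\<And>x. norm (T x) \<le> L * norm x" using norm_T_le by blast
  have "norm (T (u n)) \<le> L * C * r ^ n" for n
  proof -
    have "L * norm (u n) \<le> L * (C * r ^ n)"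
      using u(1) L(1) by (intro mult_left_mono) (auto simp: backward_orbit_def)
    then show ?thesis using L(2)[of "u n"] by simp
  qed
  then have "backward_orbit r (L * C) (\<lambda>n. T (u n))"
    using u(1) by (simp add: backward_orbit_def)
  then show "T x \<in> backward_space r" by (rule backward_spaceI) (simp add: u(2))
qed

lemma pow_in_backward_space: "x \<in> backward_space r \<Longrightarrow> (T ^^ n) x \<in> backward_space r"
  by (induction n) (auto intro: T_in_backward_space)

lemma closed_backward_space: "r > 0 \<Longrightarrow> closed (backward_space r)"
  by (metis backward_space_finite_basis closed_span_finite)

text \<open>Combining backward orbits of basis vectors linearly makes the constant proportional to the norm.\<close>

lemma uniform_backward_orbits:
  assumes "r > 0"
  obtains C where "C > 0"
    and "\<And>e. e \<in> backward_space r \<Longrightarrow> \<exists>u. backward_orbit r (C * norm e) u \<and> u 0 = e"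
proof -
  obtain B where B: "finite B" "independent B" "backward_space r = span B"
    using backward_space_finite_basis[OF assms] by blast
  have "\<forall>b\<in>B. \<exists>u C. backward_orbit r C u \<and> u 0 = b"
    using B(3) backward_spaceE by (metis span_base)
  then obtain u C where u: "\<And>b. b \<in> B \<Longrightarrow> backward_orbit r (C b) (u b)"
    and u0: "\<And>b. b \<in> B \<Longrightarrow> u b 0 = b" by metis
  obtain K where K: "coordinates_bounded B K"
    using independent_imp_coordinates_bounded B by blast
  have C0: "\<And>b. b \<in> B \<Longrightarrow> 0 \<le> C b" using backward_orbit_bound_nonneg[OF u] .
  define D where "D = (\<Sum>b\<in>B. C b) + 1"
  have D: "D > 0" using C0 unfolding D_def by (intro add_nonneg_pos sum_nonneg) auto
  have CD: "C b \<le> D" if "b \<in> B" for b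
    using member_le_sum[OF that, of C] C0 B(1) by (simp add: D_def)
  show ?thesis
  proof
    show "K * D > 0" using D coordinates_boundedD(1)[OF K] by simp
    fix e assume "e \<in> backward_space r"
    then obtain c where c: "e = (\<Sum>b\<in>B. c b *\<^sub>R b)"
      using B(3) span_finite[OF B(1)] by auto
    have "(\<Sum>b\<in>B. \<bar>c b\<bar> * C b) \<le> (\<Sum>b\<in>B. \<bar>c b\<bar>) * D"
      unfolding sum_distrib_right by (intro sum_mono mult_left_mono CD) auto
    also have "\<dots> \<le> (K * norm e) * D"
      unfolding c using D by (intro mult_right_mono coordinates_boundedD(2)[OF K]) auto
    finally have *: "backward_orbit r (K * D * norm e) (\<lambda>n. \<Sum>b\<in>B. c b *\<^sub>R u b n)"
      using assms by (intro backward_orbit_weaken[OF backward_orbit_sum[OF B(1) u]]) (auto simp: mult_ac)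
    then show "\<exists>u. backward_orbit r (K * D * norm e) u \<and> u 0 = e"
      using u0 c by (intro exI[of _ "\<lambda>n. \<Sum>b\<in>B. c b *\<^sub>R u b n"] conjI *) simp
  qed
qed

text \<open>The spaces shrink as the rate decreases to \<open>1\<close>, and their dimensions are finite, so a rate of
  minimal dimension will do.\<close>

lemma backward_space_stabilizes:
  obtains r where "1 < r" and "\<And>s. \<lbrakk>1 < s; s \<le> r\<rbrakk> \<Longrightarrow> backward_space s = backward_space r"
proof -
  obtain r :: real where r: "1 < r"
    and least: "\<And>s. 1 < s \<Longrightarrow> dim (backward_space r) \<le> dim (backward_space s)"
    using ex_has_least_nat[of "\<lambda>s::real. 1 < s" 2 "\<lambda>s. dim (backward_space s)"] by auto
  have "backward_space s = backward_space r" if s: "1 < s" "s \<le> r" for s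
  proof
    show "backward_space s \<subseteq> backward_space r" using s by (intro backward_space_mono) auto
    obtain A where A: "finite A" "independent A" "backward_space s = span A"
      using backward_space_finite_basis[of s] s(1) by auto
    obtain B where B: "finite B" "independent B" "backward_space r = span B"
      using backward_space_finite_basis[of r] r by auto
    show "backward_space r \<subseteq> backward_space s"
    proof (rule ccontr)
      assume "\<not> backward_space r \<subseteq> backward_space s"
      then obtain x where x: "x \<in> span B" "x \<notin> span A" using A(3) B(3) by blast
      then have "independent (insert x A)" using A(2) by (simp add: independent_insert)
      moreover have "insert x A \<subseteq> span B"
        using x(1) \<open>backward_space s \<subseteq> backward_space r\<close> A(3) B(3) span_base by blast
      ultimately have "card (insert x A) \<le> card B"
        using independent_span_bound[OF B(1)] by blast
      moreover have "x \<notin> A" using x(2) span_base by blast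
      ultimately have "card A < card B" using A(1) by simp
      then show False
        using least[OF s(1)] A B by (simp add: dim_eq_card_independent)
    qed
  qed
  with r that show ?thesis by blast
qed

lemma norm_pow_le: obtains L where "L \<ge> 1" and "\<And>n x. norm ((T ^^ n) x) \<le> L ^ n * norm x"
proof -
  obtain L where L: "L \<ge> 1" "\<And>x. norm (T x) \<le> L * norm x" using norm_T_le by blast
  have "norm ((T ^^ n) x) \<le> L ^ n * norm x" for n x
  proof (induction n)
    case (Suc n)
    have "norm (T ((T ^^ n) x)) \<le> L * norm ((T ^^ n) x)" by (rule L(2))
    also have "\<dots> \<le> L * (L ^ n * norm x)" using Suc L(1) by (intro mult_left_mono) auto
    finally show ?case by simp
  qed simp
  with L(1) that show ?thesis by blast
qed

end

section \<open>Decay modulo the backward space\<close>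

text \<open>The gain from stability is room between two rates.  Backward orbits in \<open>E\<close> can be taken to grow
  at a rate below \<open>r\<close>, while anything that has backward orbits of rate \<open>r\<close> already belongs to \<open>E\<close>.\<close>

locale stable_backward_space = compact_endomorphism +
  fixes r :: real
  assumes r: "1 < r"
    and stable: "\<And>s. \<lbrakk>1 < s; s \<le> r\<rbrakk> \<Longrightarrow> backward_space s = backward_space r"
begin

abbreviation "E \<equiv> backward_space r"

text \<open>A backward orbit of the quotient by \<open>E\<close> lifts.  The errors \<open>T (k (n + 1)) - k n\<close> lie in \<open>E\<close>, so they
  can be pulled back along backward orbits of a rate \<open>s < r\<close>, and subtracting the sum of the
  pull-backs makes \<open>k\<close> an exact backward orbit.  Because \<open>s < r\<close>, the corrections add up to no more
  than \<open>O(r ^ n)\<close>.  They vanish at time \<open>0\<close>.\<close>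

lemma backward_orbit_modulo:
  assumes mod: "\<And>n. T (k (Suc n)) - k n \<in> E" and bound: "\<And>n. norm (k n) \<le> D * r ^ n"
  shows "k 0 \<in> E"
proof -
  define s where "s = (1 + r) / 2"
  have s: "1 < s" "s < r" using r by (simp_all add: s_def)
  then have Es: "backward_space s = E" by (intro stable) auto
  obtain C where C: "C > 0"
    "\<And>e. e \<in> E \<Longrightarrow> \<exists>u. backward_orbit s (C * norm e) u \<and> u 0 = e"
    using uniform_backward_orbits[of s] s unfolding Es by auto
  obtain L where L: "L \<ge> 1" "\<And>x. norm (T x) \<le> L * norm x" using norm_T_le by blast
  define e where "e n = T (k (Suc n)) - k n" for n
  define D' where "D' = L * D * r + D"
  have e: "norm (e n) \<le> D' * r ^ n" for n
  proof -
    have "norm (e n) \<le> L * norm (k (Suc n)) + norm (k n)"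
      unfolding e_def using norm_triangle_ineq4 L(2) by (metis add_right_mono order_trans)
    also have "\<dots> \<le> L * (D * r ^ Suc n) + D * r ^ n"
      using L(1) by (intro add_mono mult_left_mono bound) auto
    finally show ?thesis by (simp add: D'_def algebra_simps)
  qed
  have "\<forall>n. \<exists>u. backward_orbit s (C * norm (e n)) u \<and> u 0 = e n"
    using C(2) mod by (simp add: e_def)
  then obtain u where u: "\<And>n. backward_orbit s (C * norm (e n)) (u n)" "\<And>n. u n 0 = e n"
    by metis
  define f where "f n = (\<Sum>i<n. u i (n - i))" for n
  have Tf: "T (f (Suc n)) = f n + e n" for n
  proof -
    have "T (f (Suc n)) = (\<Sum>i<Suc n. T (u i (Suc (n - i))))"
      unfolding f_def linear_sum[OF linear_T] by (intro sum.cong) (auto simp: Suc_diff_le)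
    also have "\<dots> = (\<Sum>i<Suc n. u i (n - i))"
      using u(1) by (simp add: backward_orbit_def)
    finally show ?thesis by (simp add: f_def u(2))
  qed
  have f: "norm (f n) \<le> C * D' * (s / (r - s)) * r ^ n" for n
  proof -
    have "norm (f n) \<le> (\<Sum>i<n. C * D' * (r ^ i * s ^ (n - i)))"
      unfolding f_def
    proof (rule sum_norm_le)
      fix i
      have "norm (u i (n - i)) \<le> C * norm (e i) * s ^ (n - i)"
        using u(1) by (simp add: backward_orbit_def)
      also have "\<dots> \<le> C * (D' * r ^ i) * s ^ (n - i)"
        using e C(1) s by (intro mult_right_mono mult_left_mono) auto
      finally show "norm (u i (n - i)) \<le> C * D' * (r ^ i * s ^ (n - i))" by (simp add: mult_ac)
    qed
    also have "\<dots> = C * D' * (\<Sum>i<n. r ^ i * s ^ (n - i))" by (simp add: sum_distrib_left)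
    also have "\<dots> \<le> C * D' * (s / (r - s) * r ^ n)"
    proof (intro mult_left_mono geometric_convolution_bound)
      have "0 \<le> D'" using order_trans[OF norm_ge_zero e[of 0]] by simp
      then show "0 \<le> C * D'" using C(1) by simp
    qed (use s in auto)
    finally show ?thesis by (simp add: mult_ac)
  qed
  have "norm (k n - f n) \<le> (D + C * D' * (s / (r - s))) * r ^ n" for n
    using norm_triangle_ineq4[of "k n" "f n"] bound[of n] f[of n] by (simp add: distrib_right)
  moreover have "T (k (Suc n) - f (Suc n)) = k n - f n" for n
    by (simp add: linear_diff[OF linear_T] Tf e_def)
  ultimately have "backward_orbit r (D + C * D' * (s / (r - s))) (\<lambda>n. k n - f n)"
    by (simp add: backward_orbit_def)
  then show ?thesis by (rule backward_spaceI) (simp add: f_def)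
qed

lemma closed_E: "closed E" using r by (simp add: closed_backward_space)

lemma E_nonempty: "E \<noteq> {}" using subspace_0[OF subspace_backward_space] by blast

lemma nearly_nearest: "\<exists>p\<in>E. norm (y - p) \<le> 2 * infdist y E"
  by (rule exists_nearly_nearest_point[OF closed_E E_nonempty, of y]) (auto simp: dist_norm)

text \<open>Let \<open>a n\<close> be the distance of \<open>T ^ n x\<close> from \<open>E\<close>.  If \<open>a n * r ^ n\<close> is unbounded, it has arbitrarily
  late record times \<open>n\<close>.  Divide the orbit up to a record time by \<open>a n\<close> and read it backward.  Modulo
  \<open>E\<close>, these segments start at distance \<open>1\<close> from \<open>E\<close> and grow at most like \<open>r ^ j\<close>.  By compactness a
  subsequence converges to an infinite backward orbit modulo \<open>E\<close>, still starting at
  distance at least \<open>1\<close>, which contradicts the lifting of such orbits.\<close>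

lemma infdist_E_decay: "\<exists>C. \<forall>n. infdist ((T ^^ n) x) E * r ^ n \<le> C"
proof (rule ccontr)
  define a where "a n = infdist ((T ^^ n) x) E" for n
  assume "\<not> ?thesis"
  then have "\<exists>n. C < a n * r ^ n" for C by (auto simp: a_def not_le)
  then have "\<forall>N. \<exists>n\<ge>N. 0 < a n * r ^ n \<and> (\<forall>m\<le>n. a m * r ^ m \<le> a n * r ^ n)"
    using unbounded_has_records[of "\<lambda>n. a n * r ^ n"] by blast
  then obtain \<nu> where \<nu>: "\<And>N. N \<le> \<nu> N" "\<And>N. 0 < a (\<nu> N) * r ^ \<nu> N"
    "\<And>N m. m \<le> \<nu> N \<Longrightarrow> a m * r ^ m \<le> a (\<nu> N) * r ^ \<nu> N" by metis
  have a_pos: "0 < a (\<nu> N)" for N using \<nu>(2)[of N] r by (simp add: zero_less_mult_iff)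
  have a_back: "a (\<nu> N - j) \<le> a (\<nu> N) * r ^ j" if "j \<le> \<nu> N" for N j
  proof -
    have "a (\<nu> N - j) * r ^ (\<nu> N - j) \<le> (a (\<nu> N) * r ^ j) * r ^ (\<nu> N - j)"
      using \<nu>(3)[of "\<nu> N - j" N] that by (simp add: mult.assoc flip: power_add)
    then show ?thesis using r by (simp add: mult_le_cancel_right)
  qed
  have "\<forall>m. \<exists>p\<in>E. norm ((T ^^ m) x - p) \<le> 2 * a m"
    using nearly_nearest unfolding a_def by blast
  then obtain p where p: "\<And>m. p m \<in> E" "\<And>m. norm ((T ^^ m) x - p m) \<le> 2 * a m" by metis
  obtain L where L: "L \<ge> 1" "\<And>x. norm (T x) \<le> L * norm x" using norm_T_le by blast
  \<comment> \<open>Representatives \<open>v N j\<close> modulo \<open>E\<close> of the rescaled backward segment need not range over a compact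
    set.  This is why \<open>k N j\<close> is the image of the next representative; the value \<open>0\<close> beyond the
    segment only keeps \<open>k N j\<close> in the compact set \<open>K j\<close>.\<close>
  define v where "v N j = (1 / a (\<nu> N)) *\<^sub>R ((T ^^ (\<nu> N - j)) x - p (\<nu> N - j))" for N j
  define k where "k N j = (if j < \<nu> N then T (v N (Suc j)) else 0)" for N j
  have v: "norm (v N j) \<le> 2 * r ^ j" if "j \<le> \<nu> N" for N j
  proof -
    have "norm (v N j) \<le> 2 * a (\<nu> N - j) / a (\<nu> N)"
      using p(2)[of "\<nu> N - j"] a_pos[of N] by (simp add: v_def divide_right_mono)
    also have "\<dots> \<le> 2 * r ^ j"
      using a_back[OF that] a_pos[of N] by (simp add: field_simps)
    finally show ?thesis .
  qed
  have k_eq: "k N j = (1 / a (\<nu> N)) *\<^sub>R ((T ^^ (\<nu> N - j)) x - T (p (\<nu> N - Suc j)))"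
    if "j < \<nu> N" for N j
  proof -
    have "T ((T ^^ (\<nu> N - Suc j)) x) = (T ^^ (\<nu> N - j)) x"
      using that by (metis Suc_diff_Suc funpow.simps(2) o_apply)
    then show ?thesis
      using that by (simp add: k_def v_def linear_cmul[OF linear_T] linear_diff[OF linear_T])
  qed
  define K where "K j = closure (T ` cball 0 (2 * r ^ Suc j))" for j
  have "k N j \<in> K j" for N j
  proof -
    have "k N j \<in> T ` cball 0 (2 * r ^ Suc j)"
    proof (cases "j < \<nu> N")
      case True
      then show ?thesis using v[of "Suc j" N] by (auto simp: k_def)
    next
      case False
      then have "k N j = T 0" by (simp add: k_def linear_0[OF linear_T])
      moreover have "0 \<in> cball (0 :: 'a) (2 * r ^ Suc j)" using r by simp
      ultimately show ?thesis by (metis imageI)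
    qed
    then show ?thesis unfolding K_def by (rule subsetD[OF closure_subset])
  qed
  moreover have "compact (K j)" for j unfolding K_def by (simp add: compact_image)
  ultimately obtain l \<phi> where \<phi>: "strict_mono \<phi>" and l: "\<And>j. (\<lambda>N. k (\<phi> N) j) \<longlonglongrightarrow> l j"
    using convergent_subsequence_of_coordinates[of K k] by blast
  have large: "\<forall>\<^sub>F N in sequentially. j < \<nu> (\<phi> N)" for j
  proof (rule eventually_sequentiallyI)
    fix N assume "Suc j \<le> N"
    then show "j < \<nu> (\<phi> N)" using \<nu>(1)[of "\<phi> N"] seq_suble[OF \<phi>, of N] by linarith
  qed
  have "l 0 \<in> E"
  proof (rule backward_orbit_modulo)
    fix j
    have "T (k N (Suc j)) - k N j \<in> E" if "Suc j < \<nu> N" for N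
    proof -
      have "T ((T ^^ (\<nu> N - Suc j)) x) = (T ^^ (\<nu> N - j)) x"
        using that by (metis Suc_diff_Suc Suc_lessD funpow.simps(2) o_apply)
      then have "T (k N (Suc j)) - k N j =
          (1 / a (\<nu> N)) *\<^sub>R (T (p (\<nu> N - Suc j)) - T (T (p (\<nu> N - Suc (Suc j)))))"
        using that
        by (simp add: k_eq linear_cmul[OF linear_T] linear_diff[OF linear_T] algebra_simps)
      also have "\<dots> \<in> E"
        using p(1) by (intro subspace_scale subspace_diff subspace_backward_space T_in_backward_space)
      finally show ?thesis .
    qed
    then have "\<forall>\<^sub>F N in sequentially. T (k (\<phi> N) (Suc j)) - k (\<phi> N) j \<in> E"
      using large[of "Suc j"] by (auto elim: eventually_mono)
    moreover have "(\<lambda>N. T (k (\<phi> N) (Suc j)) - k (\<phi> N) j) \<longlonglongrightarrow> T (l (Suc j)) - l j"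
      by (intro tendsto_diff tendsto_T l)
    ultimately show "T (l (Suc j)) - l j \<in> E"
      by (intro Lim_in_closed_set[OF closed_E]) auto
    have "norm (k N j) \<le> 2 * L * r * r ^ j" for N
    proof (cases "j < \<nu> N")
      case True
      then have "L * norm (v N (Suc j)) \<le> L * (2 * r ^ Suc j)"
        using L(1) by (intro mult_left_mono v) auto
      then show ?thesis using True L(2)[of "v N (Suc j)"] by (simp add: k_def mult_ac)
    qed (use r L in \<open>simp add: k_def\<close>)
    then show "norm (l j) \<le> 2 * L * r * r ^ j"
      by (intro tendsto_le[OF _ tendsto_const tendsto_norm[OF l]]) auto
  qed
  moreover have "1 \<le> dist (l 0) q" if q: "q \<in> E" for q
  proof -
    have "1 \<le> dist (k N 0) q" if "0 < \<nu> N" for N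
    proof -
      let ?p = "T (p (\<nu> N - 1)) + a (\<nu> N) *\<^sub>R q"
      have "?p \<in> E"
        using p(1) q by (intro subspace_add subspace_scale subspace_backward_space T_in_backward_space)
      then have "a (\<nu> N) \<le> norm ((T ^^ \<nu> N) x - ?p)"
        unfolding a_def dist_norm[symmetric] by (rule infdist_le)
      also have "(T ^^ \<nu> N) x - ?p = a (\<nu> N) *\<^sub>R (k N 0 - q)"
        using a_pos[of N] that by (simp add: k_eq algebra_simps)
      finally show ?thesis using a_pos[of N] by (simp add: dist_norm)
    qed
    then have "\<forall>\<^sub>F N in sequentially. 1 \<le> dist (k (\<phi> N) 0) q"
      using large[of 0] by (auto elim: eventually_mono)
    then show ?thesis
      by (intro tendsto_le[OF _ tendsto_dist[OF l tendsto_const] tendsto_const]) auto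
  qed
  ultimately show False using dist_self by (metis not_one_le_zero)
qed

text \<open>Approximate \<open>T ^ n x\<close> by \<open>p n\<close> in \<open>E\<close>.  The sequence \<open>p\<close> is an orbit up to errors \<open>g n\<close> in \<open>E\<close> of size
  \<open>O(r ^ - n)\<close>.  Pulling the error \<open>g k\<close> back by \<open>k + 1\<close> steps costs a factor \<open>s ^ (k + 1)\<close> with
  \<open>s < r\<close>, so the pull-backs are summable, and adding their sum to \<open>p 0\<close> gives a vector whose
  orbit shadows \<open>p\<close>.\<close>

lemma decomposition: "\<exists>e\<in>E. (\<lambda>n. (T ^^ n) (x - e)) \<longlonglongrightarrow> 0"
proof -
  define s where "s = (1 + r) / 2"
  have s: "1 < s" "s < r" using r by (simp_all add: s_def)
  then have Es: "backward_space s = E" by (intro stable) auto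
  obtain C where C: "C > 0"
    "\<And>e. e \<in> E \<Longrightarrow> \<exists>u. backward_orbit s (C * norm e) u \<and> u 0 = e"
    using uniform_backward_orbits[of s] s unfolding Es by auto
  obtain L where L: "L \<ge> 1" "\<And>x. norm (T x) \<le> L * norm x" using norm_T_le by blast
  define \<rho> where "\<rho> = 1 / r"
  have \<rho>: "0 < \<rho>" "\<rho> < 1" "\<rho> * s < 1" using r s by (simp_all add: \<rho>_def)
  obtain M where M: "\<And>n. infdist ((T ^^ n) x) E * r ^ n \<le> M"
    using infdist_E_decay by blast
  have "\<forall>n. \<exists>p\<in>E. norm ((T ^^ n) x - p) \<le> 2 * infdist ((T ^^ n) x) E"
    using nearly_nearest by blast
  then obtain p where p: "\<And>n. p n \<in> E"
    "\<And>n. norm ((T ^^ n) x - p n) \<le> 2 * infdist ((T ^^ n) x) E" by metis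
  define D where "D = 2 * M"
  have xp: "norm ((T ^^ n) x - p n) \<le> D * \<rho> ^ n" for n
  proof -
    have "infdist ((T ^^ n) x) E \<le> M * \<rho> ^ n"
      using M[of n] r by (simp add: \<rho>_def field_simps)
    then show ?thesis using p(2)[of n] by (simp add: D_def)
  qed
  define g where "g n = p (Suc n) - T (p n)" for n
  have gE: "g n \<in> E" for n
    unfolding g_def using p(1) by (intro subspace_diff subspace_backward_space T_in_backward_space)
  have g: "norm (g n) \<le> (L * D + D) * \<rho> ^ n" for n
  proof -
    have D0: "0 \<le> D * \<rho> ^ n" using xp[of n] norm_ge_zero order_trans by blast
    have "g n = T ((T ^^ n) x - p n) - ((T ^^ Suc n) x - p (Suc n))"
      by (simp add: g_def linear_diff[OF linear_T])
    then have "norm (g n) \<le> norm (T ((T ^^ n) x - p n)) + norm ((T ^^ Suc n) x - p (Suc n))"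
      by (metis norm_triangle_ineq4)
    also have "\<dots> \<le> L * (D * \<rho> ^ n) + D * \<rho> ^ Suc n"
      using xp[of n] L by (intro add_mono xp) (meson mult_left_mono order_trans zero_le_one)
    also have "\<dots> \<le> L * (D * \<rho> ^ n) + D * \<rho> ^ n"
      using mult_left_le_one_le[of "D * \<rho> ^ n" \<rho>] D0 \<rho> by (simp add: mult_ac)
    finally show ?thesis by (simp add: algebra_simps)
  qed
  have "\<forall>n. \<exists>u. backward_orbit s (C * norm (g n)) u \<and> u 0 = g n" using C(2) gE by simp
  then obtain u where u: "\<And>n. backward_orbit s (C * norm (g n)) (u n)" "\<And>n. u n 0 = g n"
    by metis
  have uE: "u n k \<in> E" for n k
    using backward_orbit_in_backward_space[OF u(1)] by (simp add: Es)
  define A where "A = C * (L * D + D) * s"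
  have u_bound: "norm (u (n + k) (Suc k)) \<le> \<rho> ^ n * A * (\<rho> * s) ^ k" for n k
  proof -
    have "norm (u (n + k) (Suc k)) \<le> C * norm (g (n + k)) * s ^ Suc k"
      using u(1) unfolding backward_orbit_def by blast
    also have "\<dots> \<le> C * ((L * D + D) * \<rho> ^ (n + k)) * s ^ Suc k"
      using C(1) s g by (intro mult_right_mono mult_left_mono) auto
    finally show ?thesis by (simp add: A_def power_add power_mult_distrib mult_ac)
  qed
  have geo: "summable (\<lambda>k. \<rho> ^ n * A * (\<rho> * s) ^ k)" for n
    using \<rho> s by (intro summable_mult summable_geometric) auto
  have summ: "summable (\<lambda>k. u (n + k) (Suc k))" for n
    by (rule summable_comparison_test'[OF geo u_bound])
  \<comment> \<open>The tail \<open>d n\<close> is the part of the correction that is still in force at time \<open>n\<close>: the errors from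
    time \<open>n\<close> on, pulled back to time \<open>n\<close>.\<close>
  define d where "d n = (\<Sum>k. u (n + k) (Suc k))" for n
  define e where "e = p 0 + d 0"
  have "d 0 \<in> E"
  proof (rule Lim_in_closed_set[OF closed_E])
    show "(\<lambda>n. \<Sum>k<n. u (0 + k) (Suc k)) \<longlonglongrightarrow> d 0"
      unfolding d_def by (rule summable_LIMSEQ[OF summ])
    show "\<forall>\<^sub>F n in sequentially. (\<Sum>k<n. u (0 + k) (Suc k)) \<in> E"
      by (intro always_eventually allI subspace_sum subspace_backward_space uE)
  qed simp
  then have "e \<in> E" unfolding e_def using p(1) by (intro subspace_add subspace_backward_space)
  have Td: "T (d n) = g n + d (Suc n)" for n
  proof -
    have Tu: "T (u (n + k) (Suc k)) = u (n + k) k" for k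
      using u(1) by (simp add: backward_orbit_def)
    have "T (d n) = (\<Sum>k. u (n + k) k)"
      unfolding d_def bounded_linear.suminf[OF bounded_linear_T summ] Tu ..
    moreover have "summable (\<lambda>k. u (n + k) k)"
      using bounded_linear.summable[OF bounded_linear_T summ[of n]] by (simp add: Tu)
    from suminf_split_head[OF this]
    have "(\<Sum>k. u (n + k) k) = g n + d (Suc n)" by (simp add: d_def u(2) algebra_simps)
    ultimately show ?thesis by simp
  qed
  have Te: "(T ^^ n) e = p n + d n" for n
  proof (induction n)
    case (Suc n)
    then show ?case by (simp add: linear_add[OF linear_T] Td g_def)
  qed (simp add: e_def)
  have d_bound: "norm (d n) \<le> (A * (1 / (1 - \<rho> * s))) * \<rho> ^ n" for n
  proof -
    have "norm (d n) \<le> (\<Sum>k. \<rho> ^ n * A * (\<rho> * s) ^ k)"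
      unfolding d_def by (rule norm_suminf_le[OF u_bound geo])
    also have "\<dots> = \<rho> ^ n * A * (1 / (1 - \<rho> * s))"
      using \<rho> s by (simp add: suminf_mult suminf_geometric summable_geometric)
    finally show ?thesis by (simp add: mult_ac)
  qed
  have "(\<lambda>n. (T ^^ n) (x - e)) \<longlonglongrightarrow> 0"
  proof (rule Lim_null_comparison)
    show "\<forall>\<^sub>F n in sequentially. norm ((T ^^ n) (x - e)) \<le> (D + A * (1 / (1 - \<rho> * s))) * \<rho> ^ n"
    proof (rule always_eventually, rule allI)
      fix n
      have "(T ^^ n) (x - e) = ((T ^^ n) x - p n) - d n"
        by (simp add: linear_diff[OF linear_pow] Te)
      then show "norm ((T ^^ n) (x - e)) \<le> (D + A * (1 / (1 - \<rho> * s))) * \<rho> ^ n"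
        using norm_triangle_ineq4[of "(T ^^ n) x - p n" "d n"] xp[of n] d_bound[of n]
        by (simp add: distrib_right)
    qed
    show "(\<lambda>n. (D + A * (1 / (1 - \<rho> * s))) * \<rho> ^ n) \<longlonglongrightarrow> 0"
      using \<rho> by (intro tendsto_mult_right_zero LIMSEQ_realpow_zero) auto
  qed
  with \<open>e \<in> E\<close> show ?thesis by blast
qed

section \<open>Orbits in the backward space\<close>

lemma E_basis: obtains B where "finite B" "independent B" "E = span B"
  using backward_space_finite_basis[of r] r by auto

text \<open>\<open>T\<close> maps \<open>E\<close> onto itself, because a backward orbit stays in \<open>E\<close>, and \<open>E\<close> has finite dimension.\<close>

lemma T_injective_on_E:
  assumes "v \<in> E" "T v = 0"
  shows "v = 0"
proof -
  obtain B where B: "finite B" "independent B" "E = span B" by (rule E_basis) (rule that)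
  have onto: "span B \<subseteq> span (T ` B)"
  proof
    fix e assume "e \<in> span B"
    then obtain u C where u: "backward_orbit r C u" "u 0 = e"
      using B(3) backward_spaceE by blast
    then have "T (u 1) = e" by (simp add: backward_orbit_def)
    moreover have "u 1 \<in> span B" using backward_orbit_in_backward_space[OF u(1)] B(3) by blast
    ultimately have "e \<in> T ` span B" by blast
    then show "e \<in> span (T ` B)" by (simp add: linear_span_image[OF linear_T])
  qed
  obtain A where A: "A \<subseteq> T ` B" "independent A" "T ` B \<subseteq> span A"
    using maximal_independent_subset by blast
  have fin: "finite (T ` B)" "finite A" using B(1) A(1) finite_subset by auto
  have "span (T ` B) \<subseteq> span A" using A(3) span_minimal subspace_span by blast
  then have "B \<subseteq> span A" using onto span_superset by blast
  then have "card B \<le> card A" using independent_span_bound[OF fin(2) B(2)] by blast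
  moreover have "card A \<le> card (T ` B)" using fin A(1) card_mono by blast
  moreover have "card (T ` B) \<le> card B" using B(1) by (rule card_image_le)
  ultimately have card: "card (T ` B) = card B" "card A = card (T ` B)" by auto
  then have "A = T ` B" using fin A(1) by (intro card_subset_eq) auto
  then have "independent (T ` B)" using A(2) by simp
  moreover have "inj_on T B" using B(1) card(1) by (rule eq_card_imp_inj_on)
  ultimately have "inj_on T (span B)"
    using linear_inj_on_span_iff_independent_image[OF linear_T] by blast
  then show ?thesis
    using assms B(3) by (metis inj_on_def linear_0[OF linear_T] span_zero)
qed

lemma pow_injective_on_E: "v \<in> E \<Longrightarrow> (T ^^ n) v = 0 \<Longrightarrow> v = 0"
  by (induction n) (auto intro: T_injective_on_E pow_in_backward_space)

text \<open>By injectivity the only backward orbit of \<open>T ^ n v\<close> in \<open>E\<close> passes through \<open>v\<close> after \<open>n\<close> steps, and \<open>s\<close>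
  may be as close to \<open>1\<close> as desired.\<close>

lemma subexponential_lower_bound:
  assumes s: "1 < s" "s \<le> r"
  obtains C where "C > 0" and "\<And>n v. v \<in> E \<Longrightarrow> norm v \<le> C * s ^ n * norm ((T ^^ n) v)"
proof -
  have Es: "backward_space s = E" using s by (rule stable)
  obtain C where C: "C > 0"
    "\<And>e. e \<in> E \<Longrightarrow> \<exists>u. backward_orbit s (C * norm e) u \<and> u 0 = e"
    using uniform_backward_orbits[of s] s unfolding Es by auto
  have "norm v \<le> C * s ^ n * norm ((T ^^ n) v)" if v: "v \<in> E" for n v
  proof -
    obtain u where u: "backward_orbit s (C * norm ((T ^^ n) v)) u" "u 0 = (T ^^ n) v"
      using C(2)[OF pow_in_backward_space[OF v]] by blast
    have "(T ^^ n) (u n) = (T ^^ n) v" using backward_orbit_pow[OF u(1), of n 0] u(2) by simp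
    then have "(T ^^ n) (u n - v) = 0" by (simp add: linear_diff[OF linear_pow])
    moreover have "u n - v \<in> E"
      using backward_orbit_in_backward_space[OF u(1)] v
      unfolding Es by (intro subspace_diff subspace_backward_space)
    ultimately have "u n = v" using pow_injective_on_E by force
    moreover have "norm (u n) \<le> C * norm ((T ^^ n) v) * s ^ n"
      using u(1) by (simp add: backward_orbit_def)
    ultimately show ?thesis by (simp add: mult_ac)
  qed
  with C(1) that show ?thesis by blast
qed

text \<open>Halving in every \<open>m\<close> steps would be exponential decay.\<close>

lemma no_halving_power:
  assumes "D \<subseteq> E" and inv: "\<And>v. v \<in> D \<Longrightarrow> (T ^^ m) v \<in> D"
    and half: "\<And>v. v \<in> D \<Longrightarrow> norm ((T ^^ m) v) \<le> norm v / 2" and "v \<in> D"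
  shows "v = 0"
proof (rule ccontr)
  assume "v \<noteq> 0"
  \<comment> \<open>Any rate with \<open>s ^ m < 2\<close> beats the halving.\<close>
  define s where "s = min r (root (Suc m) (3 / 2))"
  have s: "1 < s" "s \<le> r" using r by (simp_all add: s_def)
  have "s ^ m \<le> s ^ Suc m" using s(1) by (intro power_increasing) auto
  also have "\<dots> \<le> root (Suc m) (3 / 2) ^ Suc m"
    using s(1) by (intro power_mono) (auto simp: s_def)
  also have "\<dots> = 3 / 2" by (rule real_root_pow_pos2) auto
  finally have sm: "s ^ m \<le> 3 / 2" .
  obtain C where C: "C > 0" "\<And>n v. v \<in> E \<Longrightarrow> norm v \<le> C * s ^ n * norm ((T ^^ n) v)"
    using subexponential_lower_bound[OF s] by blast
  have decay: "(T ^^ (m * k)) v \<in> D \<and> norm ((T ^^ (m * k)) v) \<le> (1 / 2) ^ k * norm v" for k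
  proof (induction k)
    case (Suc k)
    have "(T ^^ (m * Suc k)) v = (T ^^ m) ((T ^^ (m * k)) v)" by (simp add: funpow_add)
    then show ?case using inv half Suc by fastforce
  qed (simp add: \<open>v \<in> D\<close>)
  obtain k :: nat where k: "(3 / 4) ^ k < 1 / C"
    using real_arch_pow_inv[of "1 / C" "3 / 4"] C(1) by auto
  have "norm v \<le> C * s ^ (m * k) * norm ((T ^^ (m * k)) v)"
    using C(2) \<open>v \<in> D\<close> assms(1) by blast
  also have "\<dots> \<le> C * (3 / 2) ^ k * ((1 / 2) ^ k * norm v)"
  proof (intro mult_mono mult_left_mono)
    show "s ^ (m * k) \<le> (3 / 2) ^ k"
      unfolding power_mult using sm s(1) by (intro power_mono) auto
  qed (use C(1) decay s(1) in auto)
  also have "\<dots> = C * (3 / 4) ^ k * norm v" by (simp flip: power_mult_distrib)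
  also have "\<dots> < norm v" using k C(1) \<open>v \<noteq> 0\<close> by (simp add: field_simps)
  finally show False by simp
qed

text \<open>It matters below that \<open>P\<close> may be any set of times, in particular the times at which one given
  orbit visits a ball.\<close>

definition bounded_at :: "nat set \<Rightarrow> 'a set"
  where "bounded_at P = {v \<in> E. \<exists>C. \<forall>n\<in>P. norm ((T ^^ n) v) \<le> C}"

lemma subspace_bounded_at: "subspace (bounded_at P)"
proof (rule subspaceI)
  show "0 \<in> bounded_at P"
    using subspace_0[OF subspace_backward_space]
    by (auto simp: bounded_at_def linear_0[OF linear_pow])
next
  fix x y assume "x \<in> bounded_at P" "y \<in> bounded_at P"
  then obtain C D where "x \<in> E" "y \<in> E" "\<forall>n\<in>P. norm ((T ^^ n) x) \<le> C" "\<forall>n\<in>P. norm ((T ^^ n) y) \<le> D"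
    by (auto simp: bounded_at_def)
  moreover from this have "\<forall>n\<in>P. norm ((T ^^ n) (x + y)) \<le> C + D"
    by (auto simp: linear_add[OF linear_pow] intro: norm_triangle_mono)
  ultimately show "x + y \<in> bounded_at P"
    by (auto simp: bounded_at_def intro: subspace_add[OF subspace_backward_space])
next
  fix t x assume "x \<in> bounded_at P"
  then obtain C where "x \<in> E" "\<forall>n\<in>P. norm ((T ^^ n) x) \<le> C" by (auto simp: bounded_at_def)
  moreover from this have "\<forall>n\<in>P. norm ((T ^^ n) (t *\<^sub>R x)) \<le> \<bar>t\<bar> * C"
    by (auto simp: linear_cmul[OF linear_pow] intro: mult_left_mono)
  ultimately show "t *\<^sub>R x \<in> bounded_at P"
    by (auto simp: bounded_at_def intro: subspace_scale[OF subspace_backward_space])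
qed

lemma pow_commute: "(T ^^ m) ((T ^^ n) x) = (T ^^ n) ((T ^^ m) x)"
  by (metis add.commute comp_apply funpow_add)

lemma pow_in_bounded_at:
  assumes "v \<in> bounded_at P" shows "(T ^^ m) v \<in> bounded_at P"
proof -
  obtain C where v: "v \<in> E" "\<And>n. n \<in> P \<Longrightarrow> norm ((T ^^ n) v) \<le> C"
    using assms by (auto simp: bounded_at_def)
  obtain L where L: "L \<ge> 1" "\<And>n x. norm ((T ^^ n) x) \<le> L ^ n * norm x" using norm_pow_le by blast
  have "norm ((T ^^ n) ((T ^^ m) v)) \<le> L ^ m * C" if "n \<in> P" for n
  proof -
    have "norm ((T ^^ m) ((T ^^ n) v)) \<le> L ^ m * norm ((T ^^ n) v)" by (rule L(2))
    also have "\<dots> \<le> L ^ m * C" using v(2)[OF that] L(1) by (intro mult_left_mono) auto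
    finally show ?thesis by (simp add: pow_commute)
  qed
  then show ?thesis using v(1) by (auto simp: bounded_at_def pow_in_backward_space)
qed

lemma subspace_of_E_basis:
  assumes "subspace F" "F \<subseteq> E"
  obtains A where "finite A" "independent A" "F = span A"
proof -
  obtain B where B: "finite B" "E = span B" by (rule E_basis) (rule that)
  have "F \<subseteq> span B" using assms(2) B(2) by simp
  then show ?thesis by (rule subspace_of_span_finite[OF B(1) assms(1)]) (rule that)
qed

lemma bounded_at_uniform:
  obtains M where "\<And>n v. n \<in> P \<Longrightarrow> v \<in> bounded_at P \<Longrightarrow> norm ((T ^^ n) v) \<le> M * norm v"
proof -
  obtain A where A: "finite A" "independent A" "bounded_at P = span A"
    by (rule subspace_of_E_basis[OF subspace_bounded_at, of P]) (auto simp: bounded_at_def)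
  obtain K where K: "K > 0"
    "\<forall>(f :: 'a \<Rightarrow> 'a) C. linear f \<longrightarrow> 0 \<le> C \<longrightarrow> (\<forall>b\<in>A. norm (f b) \<le> C) \<longrightarrow>
      (\<forall>v\<in>span A. norm (f v) \<le> K * C * norm v)"
    using linear_bound_from_basis[OF A(1,2), where 'b = 'a] by (elim exE conjE)
  have "\<forall>b\<in>A. \<exists>C. \<forall>n\<in>P. norm ((T ^^ n) b) \<le> C"
    using A(3) span_base by (fastforce simp: bounded_at_def)
  then obtain C where C: "\<And>b n. b \<in> A \<Longrightarrow> n \<in> P \<Longrightarrow> norm ((T ^^ n) b) \<le> C b" by metis
  have "norm ((T ^^ n) v) \<le> K * (\<Sum>b\<in>A. \<bar>C b\<bar>) * norm v"
    if n: "n \<in> P" and v: "v \<in> bounded_at P" for n v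
  proof (rule K(2)[rule_format, OF linear_pow])
    fix b assume b: "b \<in> A"
    have "norm ((T ^^ n) b) \<le> \<bar>C b\<bar>" using C[OF b n] by linarith
    also have "\<dots> \<le> (\<Sum>b\<in>A. \<bar>C b\<bar>)" using A(1) b by (intro member_le_sum) auto
    finally show "norm ((T ^^ n) b) \<le> (\<Sum>b\<in>A. \<bar>C b\<bar>)" .
  qed (use v A(3) in \<open>auto intro: sum_nonneg\<close>)
  then show ?thesis by (rule that)
qed

text \<open>The vectors of \<open>E\<close> that vanish along the times \<open>\<nu>\<close> form an invariant subspace of finite dimension,
  so the convergence is uniform on its unit ball, and some power of \<open>T\<close> halves all its norms.\<close>

lemma no_vanishing_times:
  assumes "v \<in> E" "(\<lambda>k. (T ^^ \<nu> k) v) \<longlonglongrightarrow> 0"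
  shows "v = 0"
proof -
  define D where "D = {v \<in> E. (\<lambda>k. (T ^^ \<nu> k) v) \<longlonglongrightarrow> 0}"
  have "subspace D"
  proof (rule subspaceI)
    show "0 \<in> D"
      using subspace_0[OF subspace_backward_space] by (simp add: D_def linear_0[OF linear_pow])
  next
    fix x y assume "x \<in> D" "y \<in> D"
    then show "x + y \<in> D"
      using tendsto_add[of "\<lambda>k. (T ^^ \<nu> k) x" 0 sequentially "\<lambda>k. (T ^^ \<nu> k) y" 0]
      by (simp add: D_def linear_add[OF linear_pow] subspace_add[OF subspace_backward_space])
  next
    fix t x assume "x \<in> D"
    then show "t *\<^sub>R x \<in> D"
      using tendsto_scaleR[of "\<lambda>_. t" t sequentially "\<lambda>k. (T ^^ \<nu> k) x" 0]
      by (simp add: D_def linear_cmul[OF linear_pow] subspace_scale[OF subspace_backward_space])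
  qed
  then obtain A where A: "finite A" "independent A" "D = span A"
    by (rule subspace_of_E_basis) (auto simp: D_def)
  obtain K where K: "K > 0"
    "\<forall>(f :: 'a \<Rightarrow> 'a) C. linear f \<longrightarrow> 0 \<le> C \<longrightarrow> (\<forall>b\<in>A. norm (f b) \<le> C) \<longrightarrow>
      (\<forall>v\<in>span A. norm (f v) \<le> K * C * norm v)"
    using linear_bound_from_basis[OF A(1,2), where 'b = 'a] by (elim exE conjE)
  have "\<forall>\<^sub>F k in sequentially. norm ((T ^^ \<nu> k) b) < 1 / (2 * K)" if "b \<in> A" for b
  proof -
    have "b \<in> D" using that A(3) span_base by blast
    then have "(\<lambda>k. norm ((T ^^ \<nu> k) b)) \<longlonglongrightarrow> 0"
      by (intro tendsto_norm_zero) (simp add: D_def)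
    then show ?thesis using K(1) by (intro order_tendstoD(2)) auto
  qed
  then have "\<forall>\<^sub>F k in sequentially. \<forall>b\<in>A. norm ((T ^^ \<nu> k) b) < 1 / (2 * K)"
    using A(1) by (simp add: eventually_ball_finite)
  then obtain k where k: "\<And>b. b \<in> A \<Longrightarrow> norm ((T ^^ \<nu> k) b) < 1 / (2 * K)"
    by (auto simp: eventually_sequentially)
  show ?thesis
  proof (rule no_halving_power)
    show "D \<subseteq> E" by (auto simp: D_def)
    show "v \<in> D" using assms by (simp add: D_def)
    fix w assume w: "w \<in> D"
    have "(\<lambda>j. (T ^^ \<nu> k) ((T ^^ \<nu> j) w)) \<longlonglongrightarrow> (T ^^ \<nu> k) 0"
      using w by (intro tendsto_pow) (simp add: D_def)
    then have "(\<lambda>j. (T ^^ \<nu> j) ((T ^^ \<nu> k) w)) \<longlonglongrightarrow> 0"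
      unfolding pow_commute[of "\<nu> k"] by (simp add: linear_0[OF linear_pow])
    then show "(T ^^ \<nu> k) w \<in> D" using w by (simp add: D_def pow_in_backward_space)
    have "norm ((T ^^ \<nu> k) w) \<le> K * (1 / (2 * K)) * norm w"
      using K(1) w A(3) by (intro K(2)[rule_format, OF linear_pow]) (auto intro: less_imp_le[OF k])
    then show "norm ((T ^^ \<nu> k) w) \<le> norm w / 2" using K(1) by simp
  qed
qed

text \<open>If unit vectors \<open>w k\<close> were shrunk more and more at times \<open>\<nu> k\<close> in \<open>P\<close>, then a limit point \<open>y\<close> of \<open>T (w k)\<close>
  would vanish along a subsequence of these times, thanks to the uniform upper bound at the times \<open>P\<close>.
  But \<open>y \<noteq> 0\<close>, since \<open>T\<close> is bounded below on \<open>E\<close>.\<close>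

lemma lower_bound_at_bounded_times:
  obtains c where "c > 0" and "\<And>n v. n \<in> P \<Longrightarrow> v \<in> bounded_at P \<Longrightarrow> c * norm v \<le> norm ((T ^^ n) v)"
proof (rule ccontr)
  assume "\<not> thesis"
  with that have neg: "\<exists>n\<in>P. \<exists>v\<in>bounded_at P. norm ((T ^^ n) v) < c * norm v" if "c > 0" for c
    using that by (meson not_less)
  have "\<exists>n w. n \<in> P \<and> w \<in> bounded_at P \<and> norm w = 1 \<and> norm ((T ^^ n) w) < 1 / real (Suc k)" for k
  proof -
    obtain n v where nv: "n \<in> P" "v \<in> bounded_at P" "norm ((T ^^ n) v) < 1 / real (Suc k) * norm v"
      using neg[of "1 / real (Suc k)"] by auto
    then have "v \<noteq> 0" by (auto simp: linear_0[OF linear_pow])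
    define w where "w = (1 / norm v) *\<^sub>R v"
    have "w \<in> bounded_at P" unfolding w_def by (intro subspace_scale subspace_bounded_at nv)
    moreover have "norm w = 1" using \<open>v \<noteq> 0\<close> by (simp add: w_def)
    moreover have "norm ((T ^^ n) w) < 1 / real (Suc k)"
      using nv(3) \<open>v \<noteq> 0\<close> by (simp add: w_def linear_cmul[OF linear_pow] field_simps)
    ultimately show ?thesis using nv(1) by blast
  qed
  then obtain \<nu> w where nP: "\<And>k. \<nu> k \<in> P" and wb: "\<And>k. w k \<in> bounded_at P"
    and w1: "\<And>k. norm (w k) = 1" and small: "\<And>k. norm ((T ^^ \<nu> k) (w k)) < 1 / real (Suc k)"
    by metis
  have "compact (closure (T ` cball 0 1))" by (simp add: compact_image)
  moreover have "\<forall>k. T (w k) \<in> closure (T ` cball 0 1)"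
    using w1 by (intro allI subsetD[OF closure_subset]) auto
  ultimately obtain y \<phi> where \<phi>: "strict_mono (\<phi> :: nat \<Rightarrow> nat)" and "((\<lambda>k. T (w k)) \<circ> \<phi>) \<longlonglongrightarrow> y"
    unfolding compact_eq_seq_compact_metric by (elim seq_compactE) auto
  then have y: "(\<lambda>k. T (w (\<phi> k))) \<longlonglongrightarrow> y" by (simp add: o_def)
  obtain L where L: "L \<ge> 1" "\<And>x. norm (T x) \<le> L * norm x" using norm_T_le by blast
  obtain M where M: "\<And>n v. n \<in> P \<Longrightarrow> v \<in> bounded_at P \<Longrightarrow> norm ((T ^^ n) v) \<le> M * norm v"
    using bounded_at_uniform by blast
  have "closed (bounded_at P)"
  proof -
    obtain A where "finite A" "bounded_at P = span A"
      by (rule subspace_of_E_basis[OF subspace_bounded_at, of P]) (auto simp: bounded_at_def)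
    then show ?thesis by (simp add: closed_span_finite)
  qed
  have Tw: "T (w k) \<in> bounded_at P" for k using pow_in_bounded_at[OF wb, of 1] by simp
  then have yb: "y \<in> bounded_at P"
    by (intro Lim_in_closed_set[OF \<open>closed (bounded_at P)\<close> _ _ y]) auto
  have "(\<lambda>k. (T ^^ \<nu> (\<phi> k)) y) \<longlonglongrightarrow> 0"
  proof (rule Lim_null_comparison)
    show "\<forall>\<^sub>F k in sequentially. norm ((T ^^ \<nu> (\<phi> k)) y)
        \<le> M * norm (y - T (w (\<phi> k))) + L * (1 / real (Suc k))"
    proof (rule always_eventually, rule allI)
      fix k
      let ?n = "\<nu> (\<phi> k)" and ?w = "w (\<phi> k)"
      have "(T ^^ ?n) y = (T ^^ ?n) (y - T ?w) + T ((T ^^ ?n) ?w)"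
        by (simp add: linear_diff[OF linear_pow] funpow_swap1)
      moreover have "norm ((T ^^ ?n) (y - T ?w)) \<le> M * norm (y - T ?w)"
        by (intro M nP subspace_diff subspace_bounded_at yb Tw)
      moreover have "norm (T ((T ^^ ?n) ?w)) \<le> L * (1 / real (Suc k))"
      proof -
        have "norm ((T ^^ ?n) ?w) \<le> 1 / real (Suc (\<phi> k))" using small less_imp_le by blast
        also have "\<dots> \<le> 1 / real (Suc k)" using seq_suble[OF \<phi>, of k] by (simp add: frac_le)
        finally have "L * norm ((T ^^ ?n) ?w) \<le> L * (1 / real (Suc k))"
          using L(1) by (intro mult_left_mono) auto
        then show ?thesis using L(2) order_trans by blast
      qed
      ultimately show "norm ((T ^^ ?n) y) \<le> M * norm (y - T ?w) + L * (1 / real (Suc k))"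
        by (metis norm_triangle_mono)
    qed
    have "(\<lambda>k. M * norm (y - T (w (\<phi> k))) + L * (1 / real (Suc k))) \<longlonglongrightarrow> M * norm (y - y) + L * 0"
      by (intro tendsto_intros y) (use LIMSEQ_inverse_real_of_nat in \<open>simp add: inverse_eq_divide\<close>)
    then show "(\<lambda>k. M * norm (y - T (w (\<phi> k))) + L * (1 / real (Suc k))) \<longlonglongrightarrow> 0" by simp
  qed
  then have "y = 0" using yb by (intro no_vanishing_times) (auto simp: bounded_at_def)
  obtain C where C: "C > 0" "\<And>n v. v \<in> E \<Longrightarrow> norm v \<le> C * r ^ n * norm ((T ^^ n) v)"
    using subexponential_lower_bound[OF r order_refl] by blast
  have "1 / (C * r) \<le> norm (T (w k))" for k
    using C(2)[of "w k" 1] wb[of k] w1[of k] C(1) r by (simp add: bounded_at_def field_simps)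
  then have "1 / (C * r) \<le> norm y"
    by (intro tendsto_le[OF _ tendsto_norm[OF y] tendsto_const]) auto
  moreover have "1 / (C * r) > 0" using C(1) r by simp
  ultimately show False using \<open>y = 0\<close> by simp
qed

lemma bounded_orbit_in_E_bounded_below:
  assumes "e \<in> E" "e \<noteq> 0" and "\<And>n. norm ((T ^^ n) e) \<le> M"
  shows "\<exists>d>0. \<forall>n. d \<le> norm ((T ^^ n) e)"
proof -
  obtain c where c: "c > 0"
    "\<And>n v. n \<in> UNIV \<Longrightarrow> v \<in> bounded_at UNIV \<Longrightarrow> c * norm v \<le> norm ((T ^^ n) v)"
    using lower_bound_at_bounded_times[of UNIV] by blast
  moreover have "e \<in> bounded_at UNIV" using assms by (auto simp: bounded_at_def)
  ultimately show ?thesis using assms(2) by (intro exI[of _ "c * norm e"]) auto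
qed

text \<open>Let \<open>P\<close> be the times at which the orbit of \<open>e\<close> is in a ball of radius \<open>R \<ge> 2 * \<parallel>e\<parallel>\<close>.  The points
  visited at times in \<open>P\<close> form a precompact set, so a finite set \<open>I\<close> of positive times in \<open>P\<close> is such
  that \<open>T ^ n e\<close>, for any positive \<open>n\<close> in \<open>P\<close>, is close to \<open>T ^ i e\<close> with \<open>i\<close> in \<open>I\<close>.  For \<open>n > i\<close> the
  lower bound at time \<open>i\<close>, applied to \<open>T ^ (n - i) e - e\<close>, makes this difference no larger than \<open>e\<close>, so
  \<open>n - i\<close> is in \<open>P\<close> again.  Hence gaps in \<open>P\<close> are no longer than the maximum of \<open>I\<close>, and the orbit
  cannot grow much within a bounded gap.\<close>

lemma bounded_if_recurrently_bounded:
  assumes e: "e \<in> E" and rec: "\<And>N. \<exists>n\<ge>N. norm ((T ^^ n) e) < R0"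
  shows "\<exists>M. \<forall>n. norm ((T ^^ n) e) \<le> M"
proof (cases "e = 0")
  case True
  then show ?thesis by (intro exI[of _ 0]) (simp add: linear_0[OF linear_pow])
next
  case False
  define R where "R = max R0 (2 * norm e)"
  define P where "P = {n. norm ((T ^^ n) e) \<le> R}"
  have rec: "\<exists>n\<ge>N. n \<in> P" for N
    using rec[of N] by (auto simp: P_def R_def intro: less_imp_le max.strict_coboundedI1)
  have eb: "e \<in> bounded_at P" using e by (auto simp: bounded_at_def P_def)
  obtain c where c: "c > 0"
    "\<And>n v. n \<in> P \<Longrightarrow> v \<in> bounded_at P \<Longrightarrow> c * norm v \<le> norm ((T ^^ n) v)"
    using lower_bound_at_bounded_times[of P] by blast
  obtain C where C: "C > 0" "\<And>n v. v \<in> E \<Longrightarrow> norm v \<le> C * r ^ n * norm ((T ^^ n) v)"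
    using subexponential_lower_bound[OF r order_refl] by blast
  \<comment> \<open>Time \<open>0\<close> is left out so that a step back by a time in \<open>I\<close> is a step down.\<close>
  define S where "S = (\<lambda>n. (T ^^ n) e) ` (P - {0})"
  have "S \<subseteq> T ` cball 0 (C * r * R)"
  proof
    fix z assume "z \<in> S"
    then obtain n where n: "n \<in> P" "n \<noteq> 0" "z = (T ^^ n) e" by (auto simp: S_def)
    then obtain m where m: "n = Suc m" by (cases n) auto
    have "norm ((T ^^ m) e) \<le> C * r * norm ((T ^^ n) e)"
      using C(2)[OF pow_in_backward_space[OF e], of m 1] by (simp add: m)
    also have "\<dots> \<le> C * r * R"
      using n(1) C(1) r by (intro mult_left_mono) (auto simp: P_def)
    finally show "z \<in> T ` cball 0 (C * r * R)" using n(3) m by auto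
  qed
  then have "closure S \<subseteq> closure (T ` cball 0 (C * r * R))" by (rule closure_mono)
  moreover have "compact (closure (T ` cball 0 (C * r * R)))" by (simp add: compact_image)
  ultimately have cS: "compact (closure S)"
    using compact_Int_closed[OF _ closed_closure] by (metis inf.absorb_iff2)
  have cover: "closure S \<subseteq> (\<Union>n\<in>P - {0}. ball ((T ^^ n) e) (c * norm e))"
  proof
    fix z assume "z \<in> closure S"
    moreover have "c * norm e > 0" using c(1) False by simp
    ultimately obtain z' where "z' \<in> S" "dist z' z < c * norm e"
      using closure_approachable by blast
    then show "z \<in> (\<Union>n\<in>P - {0}. ball ((T ^^ n) e) (c * norm e))" by (auto simp: S_def)
  qed
  obtain I where I: "I \<subseteq> P - {0}" "finite I"
    "closure S \<subseteq> (\<Union>n\<in>I. ball ((T ^^ n) e) (c * norm e))"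
    by (rule compactE_image[OF cS _ cover]) (rule open_ball, rule that)
  define g where "g = Max (insert 0 I)"
  have g: "i \<le> g" if "i \<in> I" for i using I(2) that by (simp add: g_def)
  have predecessor: "\<exists>i. 0 < i \<and> i \<le> g \<and> n - i \<in> P" if n: "n \<in> P" "g < n" for n
  proof -
    have "(T ^^ n) e \<in> S" using n by (auto simp: S_def)
    then obtain i where i: "i \<in> I" "dist ((T ^^ i) e) ((T ^^ n) e) < c * norm e"
      using I(3) closure_subset[of S] by fastforce
    have "i \<in> P" "0 < i" using i(1) I(1) by auto
    have "n = i + (n - i)" using g[OF i(1)] n(2) by simp
    then have "(T ^^ n) e = (T ^^ i) ((T ^^ (n - i)) e)" by (metis comp_apply funpow_add)
    then have "dist ((T ^^ i) e) ((T ^^ n) e) = norm ((T ^^ i) ((T ^^ (n - i)) e - e))"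
      by (simp add: linear_diff[OF linear_pow] dist_norm norm_minus_commute)
    moreover have "c * norm ((T ^^ (n - i)) e - e) \<le> norm ((T ^^ i) ((T ^^ (n - i)) e - e))"
      by (intro c(2) \<open>i \<in> P\<close> subspace_diff subspace_bounded_at pow_in_bounded_at eb)
    ultimately have "c * norm ((T ^^ (n - i)) e - e) \<le> c * norm e" using i(2) by linarith
    then have "norm ((T ^^ (n - i)) e - e) \<le> norm e" using c(1) by simp
    then have "norm ((T ^^ (n - i)) e) \<le> 2 * norm e"
      using norm_triangle_sub[of "(T ^^ (n - i)) e" e] by simp
    then show ?thesis using \<open>0 < i\<close> g[OF i(1)] by (intro exI[of _ i]) (simp add: P_def R_def)
  qed
  have gap: "\<exists>n\<in>P. n \<le> m \<and> m \<le> n + g" for m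
  proof -
    \<comment> \<open>Step back from the first visit after \<open>m\<close>: the visit found there is not after \<open>m\<close>.\<close>
    define n where "n = (LEAST n. n \<in> P \<and> m < n)"
    have "\<exists>n. n \<in> P \<and> m < n" using rec[of "Suc m"] by auto
    then have n: "n \<in> P" "m < n" unfolding n_def by (metis (mono_tags, lifting) LeastI)+
    have least: "k \<le> m" if "k \<in> P" "k < n" for k
      using not_less_Least[of k "\<lambda>n. n \<in> P \<and> m < n"] that unfolding n_def by auto
    show ?thesis
    proof (cases "g < n")
      case True
      then obtain i where i: "0 < i" "i \<le> g" "n - i \<in> P" using predecessor n(1) by blast
      then have "n - i \<le> m" using n by (intro least) auto
      then show ?thesis using i n(2) by (intro bexI[of _ "n - i"]) auto
    next
      case False
      have "norm e \<le> R" using norm_ge_zero[of e] unfolding R_def by linarith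
      then have "0 \<in> P" by (simp add: P_def)
      then show ?thesis using False n(2) by (intro bexI[of _ 0]) auto
    qed
  qed
  obtain L where L: "L \<ge> 1" "\<And>n x. norm ((T ^^ n) x) \<le> L ^ n * norm x" using norm_pow_le by blast
  have "norm ((T ^^ m) e) \<le> L ^ g * R" for m
  proof -
    obtain n where n: "n \<in> P" "n \<le> m" "m \<le> n + g" using gap by blast
    have "(T ^^ m) e = (T ^^ (m - n)) ((T ^^ n) e)"
      using n(2) by (metis comp_apply funpow_add le_add_diff_inverse2)
    then have "norm ((T ^^ m) e) \<le> L ^ (m - n) * norm ((T ^^ n) e)" using L(2) by metis
    also have "\<dots> \<le> L ^ g * R"
      using n L(1) by (intro mult_mono power_increasing) (auto simp: P_def)
    finally show ?thesis .
  qed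
  then show ?thesis by blast
qed

end

section \<open>Decaying, bounded and divergent orbits\<close>

definition decaying_vectors :: "('a::real_normed_vector \<Rightarrow> 'a) \<Rightarrow> 'a set"
  where "decaying_vectors T = {x. (\<lambda>n. norm ((T ^^ n) x)) \<longlonglongrightarrow> 0}"

definition bounded_vectors :: "('a::real_normed_vector \<Rightarrow> 'a) \<Rightarrow> 'a set"
  where "bounded_vectors T = {x. \<exists>M. \<forall>n. norm ((T ^^ n) x) \<le> M}"

lemma decaying_subset_bounded: "decaying_vectors T \<subseteq> bounded_vectors T"
proof
  fix x assume "x \<in> decaying_vectors T"
  then have "Bseq (\<lambda>n. norm ((T ^^ n) x))"
    by (simp add: decaying_vectors_def convergentI convergent_imp_Bseq)
  then show "x \<in> bounded_vectors T" by (auto simp: bounded_vectors_def Bseq_def)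
qed

context stable_backward_space
begin

lemma decompose_orbit:
  obtains e z where "e \<in> E" "z \<in> decaying_vectors T" "\<And>n. (T ^^ n) x = (T ^^ n) e + (T ^^ n) z"
proof -
  obtain e where "e \<in> E" "(\<lambda>n. (T ^^ n) (x - e)) \<longlonglongrightarrow> 0" using decomposition by blast
  moreover from this have "x - e \<in> decaying_vectors T"
    unfolding decaying_vectors_def by (simp add: tendsto_norm_zero)
  moreover have "(T ^^ n) x = (T ^^ n) e + (T ^^ n) (x - e)" for n
    by (simp add: linear_diff[OF linear_pow])
  ultimately show ?thesis by (intro that)
qed

lemma decaying_vectors_finite_codim:
  "\<exists>B. finite B \<and> (\<forall>x. \<exists>c. x - (\<Sum>b\<in>B. c b *\<^sub>R b) \<in> decaying_vectors T)"
proof -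
  obtain B where B: "finite B" "E = span B" by (rule E_basis) (rule that)
  have "\<exists>c. x - (\<Sum>b\<in>B. c b *\<^sub>R b) \<in> decaying_vectors T" for x
  proof -
    obtain e where e: "e \<in> E" "(\<lambda>n. (T ^^ n) (x - e)) \<longlonglongrightarrow> 0" using decomposition by blast
    then obtain c where c: "e = (\<Sum>b\<in>B. c b *\<^sub>R b)"
      using B span_finite[OF B(1)] by auto
    have "x - e \<in> decaying_vectors T"
      using e(2) by (simp add: decaying_vectors_def tendsto_norm_zero)
    then show ?thesis unfolding c by blast
  qed
  with B(1) show ?thesis by blast
qed

text \<open>A decaying summand changes an orbit only by a bounded amount, so the alternative for orbits in \<open>E\<close>
  carries over.\<close>

lemma unbounded_diverges:
  assumes "x \<notin> bounded_vectors T"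
  shows "filterlim (\<lambda>n. norm ((T ^^ n) x)) at_top sequentially"
proof -
  obtain e z where ez: "e \<in> E" "z \<in> decaying_vectors T" "\<And>n. (T ^^ n) x = (T ^^ n) e + (T ^^ n) z"
    using decompose_orbit[of x] by blast
  obtain M where M: "\<And>n. norm ((T ^^ n) z) \<le> M"
    using subsetD[OF decaying_subset_bounded ez(2)] by (auto simp: bounded_vectors_def)
  show ?thesis
  proof (rule ccontr)
    assume "\<not> ?thesis"
    then obtain Q where "\<not> (\<forall>\<^sub>F n in sequentially. Q \<le> norm ((T ^^ n) x))"
      by (auto simp: filterlim_at_top)
    then have Q: "\<exists>n\<ge>N. norm ((T ^^ n) x) < Q" for N
      by (auto simp: eventually_sequentially not_le)
    have "\<exists>n\<ge>N. norm ((T ^^ n) e) < Q + M" for N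
    proof -
      obtain n where n: "n \<ge> N" "norm ((T ^^ n) x) < Q" using Q by blast
      have "norm ((T ^^ n) e) \<le> norm ((T ^^ n) x) + norm ((T ^^ n) z)"
        using norm_triangle_ineq4[of "(T ^^ n) x" "(T ^^ n) z"] ez(3)[of n] by simp
      then show ?thesis using n M[of n] by (intro exI[of _ n]) auto
    qed
    then obtain M' where M': "\<And>n. norm ((T ^^ n) e) \<le> M'"
      using bounded_if_recurrently_bounded[OF ez(1)] by blast
    have "norm ((T ^^ n) x) \<le> M' + M" for n
      unfolding ez(3) by (rule norm_triangle_mono[OF M' M])
    then show False using assms by (auto simp: bounded_vectors_def)
  qed
qed

text \<open>The lower bound for the component in \<open>E\<close> only survives at late times.  At early times it suffices
  that the orbit never reaches \<open>0\<close>, where it would stay.\<close>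

lemma bounded_not_decaying_bounds:
  assumes "x \<in> bounded_vectors T" "x \<notin> decaying_vectors T"
  shows "\<exists>M>0. \<forall>n. inverse M \<le> norm ((T ^^ n) x) \<and> norm ((T ^^ n) x) \<le> M"
proof -
  obtain e z where ez: "e \<in> E" "z \<in> decaying_vectors T" "\<And>n. (T ^^ n) x = (T ^^ n) e + (T ^^ n) z"
    using decompose_orbit[of x] by blast
  obtain M where M: "\<And>n. norm ((T ^^ n) x) \<le> M" using assms(1) by (auto simp: bounded_vectors_def)
  obtain M' where M': "\<And>n. norm ((T ^^ n) z) \<le> M'"
    using subsetD[OF decaying_subset_bounded ez(2)] by (auto simp: bounded_vectors_def)
  have "norm ((T ^^ n) e) \<le> M + M'" for n
    using norm_triangle_ineq4[of "(T ^^ n) x" "(T ^^ n) z"] ez(3)[of n] M[of n] M'[of n] by simp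
  moreover have "e \<noteq> 0"
    using assms(2) ez(2,3) by (auto simp: decaying_vectors_def linear_0[OF linear_pow])
  ultimately obtain d where d: "d > 0" "\<And>n. d \<le> norm ((T ^^ n) e)"
    using bounded_orbit_in_E_bounded_below[OF ez(1)] by blast
  have "(\<lambda>n. norm ((T ^^ n) z)) \<longlonglongrightarrow> 0" using ez(2) by (simp add: decaying_vectors_def)
  then have "\<forall>\<^sub>F n in sequentially. norm ((T ^^ n) z) < d / 2"
    using d(1) by (intro order_tendstoD(2)) auto
  then obtain N where N: "\<And>n. n \<ge> N \<Longrightarrow> norm ((T ^^ n) z) < d / 2"
    by (auto simp: eventually_sequentially)
  have late: "d / 2 \<le> norm ((T ^^ n) x)" if "n \<ge> N" for n
    using norm_triangle_ineq4[of "(T ^^ n) x" "(T ^^ n) z"] ez(3)[of n] d(2)[of n] N[OF that] by simp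
  have nonzero: "(T ^^ n) x \<noteq> 0" for n
  proof
    assume "(T ^^ n) x = 0"
    then have "(T ^^ (N + n)) x = 0" by (simp add: funpow_add linear_0[OF linear_pow])
    then show False using late[of "N + n"] d(1) by simp
  qed
  define \<delta> where "\<delta> = Min (insert (d / 2) ((\<lambda>n. norm ((T ^^ n) x)) ` {..<N}))"
  have \<delta>: "\<delta> > 0" using d(1) nonzero by (auto simp: \<delta>_def)
  have lower: "\<delta> \<le> norm ((T ^^ n) x)" for n
  proof (cases "n < N")
    case True
    then show ?thesis unfolding \<delta>_def by (intro Min_le) auto
  next
    case False
    have "\<delta> \<le> d / 2" unfolding \<delta>_def by (intro Min_le) auto
    then show ?thesis using late[of n] False by simp
  qed
  define M0 where "M0 = max M (inverse \<delta>)"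
  have "M0 > 0" using \<delta> by (simp add: M0_def less_max_iff_disj)
  moreover have "inverse M0 \<le> \<delta>"
    using \<delta> le_imp_inverse_le[of "inverse \<delta>" M0] by (simp add: M0_def)
  ultimately show ?thesis
    using lower M by (intro exI[of _ M0]) (auto simp: M0_def intro: order_trans max.coboundedI1)
qed

end

lemma finite_codim_subspaceI:
  fixes smul :: "'k::field \<Rightarrow> 'a::ab_group_add \<Rightarrow> 'a"
  assumes "module smul" and V: "module.subspace smul V" and "finite B"
    and rep: "\<And>x. \<exists>c. x - (\<Sum>b\<in>B. smul (c b) b) \<in> V"
  shows "finite_codim_subspace smul V"
proof -
  interpret module smul by fact
  have "quot_class V x = quot_class V y" if "x - y \<in> V" for x y
  proof -
    have sub: "quot_class V x \<subseteq> quot_class V y" if "x - y \<in> V" for x y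
    proof
      fix w assume "w \<in> quot_class V x"
      then obtain v where v: "v \<in> V" "w = x + v" by (auto simp: quot_class_def)
      have "x - y + v \<in> V" using that v(1) V by (intro subspace_add)
      moreover have "w = y + (x - y + v)" using v(2) by simp
      ultimately show "w \<in> quot_class V y" unfolding quot_class_def by blast
    qed
    have "- (x - y) \<in> V" using that V by (intro subspace_neg)
    then have "y - x \<in> V" by simp
    then show ?thesis using sub that by blast
  qed
  then show ?thesis
    unfolding finite_codim_subspace_def using V assms(3) rep by meson
qed

text \<open>Real and complex scalars are treated together: \<open>\<iota>\<close> embeds the reals into the scalar field and \<open>\<mu>\<close> is
  the absolute value of the field.\<close>

lemma compact_operator_trichotomy:
  fixes smul :: "'k::field \<Rightarrow> 'a::banach \<Rightarrow> 'a" and \<iota> :: "real \<Rightarrow> 'k" and \<mu> :: "'k \<Rightarrow> real"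
  assumes "vector_space smul"
    and norm_smul: "\<And>c x. norm (smul c x) = \<mu> c * norm x"
    and smul_\<iota>: "\<And>t x. smul (\<iota> t) x = t *\<^sub>R x"
    and compact: "compact_operator smul T"
  shows "\<exists>Z Y. finite_codim_subspace smul Z \<and> finite_codim_subspace smul Y \<and> Z \<subseteq> Y
    \<and> (\<forall>x. x \<notin> Y \<longrightarrow> filterlim (\<lambda>n. norm ((T ^^ n) x)) at_top sequentially)
    \<and> (\<forall>x\<in>Y - Z. \<exists>M::real. M > 0 \<and>
          (\<forall>n. inverse M \<le> norm ((T ^^ n) x) \<and> norm ((T ^^ n) x) \<le> M))
    \<and> (\<forall>x\<in>Z. (\<lambda>n. norm ((T ^^ n) x)) \<longlonglongrightarrow> 0)"
proof -
  interpret vector_space smul by fact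
  have lin: "Vector_Spaces.linear smul smul T"
    and cpt: "\<And>S. bounded S \<Longrightarrow> compact (closure (T ` S))"
    using compact by (auto simp: compact_operator_def)
  have add: "T (x + y) = T x + T y" and smul: "T (smul c x) = smul c (T x)" for x y c
    using lin unfolding linear_iff_module_hom module_hom_iff by auto
  have "linear T"
  proof (rule linearI)
    show "T (t *\<^sub>R x) = t *\<^sub>R T x" for t x using smul[of "\<iota> t" x] by (simp add: smul_\<iota>)
  qed (rule add)
  interpret compact_endomorphism T
    by (rule compact_endomorphism.intro[OF \<open>linear T\<close> cpt])
  obtain r where r: "1 < r" "\<And>s. \<lbrakk>1 < s; s \<le> r\<rbrakk> \<Longrightarrow> backward_space s = backward_space r"
    by (rule backward_space_stabilizes) blast
  interpret stable_backward_space T r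
    by (intro stable_backward_space.intro stable_backward_space_axioms.intro
        compact_endomorphism_axioms r)
  let ?Z = "decaying_vectors T" and ?Y = "bounded_vectors T"
  have pow_smul: "(T ^^ n) (smul c x) = smul c ((T ^^ n) x)" for n c x
    by (induction n) (simp_all add: smul)
  have subZ: "subspace ?Z"
  proof (rule subspaceI)
    show "0 \<in> ?Z" by (simp add: decaying_vectors_def linear_0[OF linear_pow])
  next
    fix x y assume "x \<in> ?Z" "y \<in> ?Z"
    then have "(\<lambda>n. (T ^^ n) x + (T ^^ n) y) \<longlonglongrightarrow> 0"
      unfolding decaying_vectors_def by (auto intro: tendsto_add_zero dest: tendsto_norm_zero_cancel)
    then show "x + y \<in> ?Z"
      by (simp add: decaying_vectors_def linear_add[OF linear_pow] tendsto_norm_zero)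
  next
    fix c x assume "x \<in> ?Z"
    then show "smul c x \<in> ?Z"
      by (auto simp: decaying_vectors_def pow_smul norm_smul intro: tendsto_mult_right_zero)
  qed
  have subY: "subspace ?Y"
  proof (rule subspaceI)
    show "0 \<in> ?Y" by (auto simp: bounded_vectors_def linear_0[OF linear_pow])
  next
    fix x y assume "x \<in> ?Y" "y \<in> ?Y"
    then obtain M M' where "\<And>n. norm ((T ^^ n) x) \<le> M" "\<And>n. norm ((T ^^ n) y) \<le> M'"
      by (auto simp: bounded_vectors_def)
    then have "norm ((T ^^ n) (x + y)) \<le> M + M'" for n
      unfolding linear_add[OF linear_pow] by (intro norm_triangle_mono)
    then show "x + y \<in> ?Y" by (auto simp: bounded_vectors_def)
  next
    fix c x assume "x \<in> ?Y"
    then obtain M where M: "\<And>n. norm ((T ^^ n) x) \<le> M" by (auto simp: bounded_vectors_def)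
    have "norm ((T ^^ n) (smul c x)) \<le> \<bar>\<mu> c\<bar> * M" for n
      unfolding pow_smul norm_smul using M by (intro mult_mono) auto
    then show "smul c x \<in> ?Y" by (auto simp: bounded_vectors_def)
  qed
  obtain B where B: "finite B" "\<And>x. \<exists>c. x - (\<Sum>b\<in>B. c b *\<^sub>R b) \<in> ?Z"
    using decaying_vectors_finite_codim by blast
  have rep: "\<exists>c. x - (\<Sum>b\<in>B. smul (c b) b) \<in> ?Z" for x
  proof -
    obtain c where "x - (\<Sum>b\<in>B. c b *\<^sub>R b) \<in> ?Z" using B(2) by blast
    then show ?thesis by (intro exI[of _ "\<lambda>b. \<iota> (c b)"]) (simp add: smul_\<iota>)
  qed
  show ?thesis
  proof (rule exI[of _ ?Z], rule exI[of _ ?Y], intro conjI)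
    show "finite_codim_subspace smul ?Z"
      by (rule finite_codim_subspaceI[OF module_axioms subZ B(1) rep])
    show "finite_codim_subspace smul ?Y"
      using rep decaying_subset_bounded
      by (intro finite_codim_subspaceI[OF module_axioms subY B(1)]) blast
    show "?Z \<subseteq> ?Y" by (rule decaying_subset_bounded)
    show "\<forall>x. x \<notin> ?Y \<longrightarrow> filterlim (\<lambda>n. norm ((T ^^ n) x)) at_top sequentially"
      using unbounded_diverges by blast
    show "\<forall>x\<in>?Y - ?Z. \<exists>M::real. M > 0 \<and>
          (\<forall>n. inverse M \<le> norm ((T ^^ n) x) \<and> norm ((T ^^ n) x) \<le> M)"
      using bounded_not_decaying_bounds by blast
    show "\<forall>x\<in>?Z. (\<lambda>n. norm ((T ^^ n) x)) \<longlonglongrightarrow> 0" by (simp add: decaying_vectors_def)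
  qed
qed

theorem proposition1p3:
  fixes T :: "'a::banach \<Rightarrow> 'a"
    and U :: "'b::complex_banach \<Rightarrow> 'b"
  shows
    "(compact_operator (scaleR :: real \<Rightarrow> 'a \<Rightarrow> 'a) T \<longrightarrow>
      (\<exists>Z Y. finite_codim_subspace (scaleR :: real \<Rightarrow> 'a \<Rightarrow> 'a) Z
        \<and> finite_codim_subspace (scaleR :: real \<Rightarrow> 'a \<Rightarrow> 'a) Y
        \<and> Z \<subseteq> Y
        \<and> (\<forall>x. x \<notin> Y \<longrightarrow> filterlim (\<lambda>n. norm ((T ^^ n) x)) at_top sequentially)
        \<and> (\<forall>x\<in>Y - Z. \<exists>M::real. M > 0 \<and>
              (\<forall>n. inverse M \<le> norm ((T ^^ n) x) \<and> norm ((T ^^ n) x) \<le> M))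
        \<and> (\<forall>x\<in>Z. (\<lambda>n. norm ((T ^^ n) x)) \<longlonglongrightarrow> 0)))
    \<and>
    (compact_operator (scaleC :: complex \<Rightarrow> 'b \<Rightarrow> 'b) U \<longrightarrow>
      (\<exists>Z Y. finite_codim_subspace (scaleC :: complex \<Rightarrow> 'b \<Rightarrow> 'b) Z
        \<and> finite_codim_subspace (scaleC :: complex \<Rightarrow> 'b \<Rightarrow> 'b) Y
        \<and> Z \<subseteq> Y
        \<and> (\<forall>x. x \<notin> Y \<longrightarrow> filterlim (\<lambda>n. norm ((U ^^ n) x)) at_top sequentially)
        \<and> (\<forall>x\<in>Y - Z. \<exists>M::real. M > 0 \<and>
              (\<forall>n. inverse M \<le> norm ((U ^^ n) x) \<and> norm ((U ^^ n) x) \<le> M))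
        \<and> (\<forall>x\<in>Z. (\<lambda>n. norm ((U ^^ n) x)) \<longlonglongrightarrow> 0)))"
proof (intro conjI impI)
  assume "compact_operator (scaleR :: real \<Rightarrow> 'a \<Rightarrow> 'a) T"
  with real_vector.vector_space_axioms show "\<exists>Z Y. finite_codim_subspace (scaleR :: real \<Rightarrow> 'a \<Rightarrow> 'a) Z
        \<and> finite_codim_subspace (scaleR :: real \<Rightarrow> 'a \<Rightarrow> 'a) Y
        \<and> Z \<subseteq> Y
        \<and> (\<forall>x. x \<notin> Y \<longrightarrow> filterlim (\<lambda>n. norm ((T ^^ n) x)) at_top sequentially)
        \<and> (\<forall>x\<in>Y - Z. \<exists>M::real. M > 0 \<and>
              (\<forall>n. inverse M \<le> norm ((T ^^ n) x) \<and> norm ((T ^^ n) x) \<le> M))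
        \<and> (\<forall>x\<in>Z. (\<lambda>n. norm ((T ^^ n) x)) \<longlonglongrightarrow> 0)"
    by (intro compact_operator_trichotomy[where \<mu> = abs and \<iota> = "\<lambda>t. t"]) auto
next
  assume "compact_operator (scaleC :: complex \<Rightarrow> 'b \<Rightarrow> 'b) U"
  with vector_space_scaleC show "\<exists>Z Y. finite_codim_subspace (scaleC :: complex \<Rightarrow> 'b \<Rightarrow> 'b) Z
        \<and> finite_codim_subspace (scaleC :: complex \<Rightarrow> 'b \<Rightarrow> 'b) Y
        \<and> Z \<subseteq> Y
        \<and> (\<forall>x. x \<notin> Y \<longrightarrow> filterlim (\<lambda>n. norm ((U ^^ n) x)) at_top sequentially)
        \<and> (\<forall>x\<in>Y - Z. \<exists>M::real. M > 0 \<and>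
              (\<forall>n. inverse M \<le> norm ((U ^^ n) x) \<and> norm ((U ^^ n) x) \<le> M))
        \<and> (\<forall>x\<in>Z. (\<lambda>n. norm ((U ^^ n) x)) \<longlonglongrightarrow> 0)"
    by (intro compact_operator_trichotomy[where \<mu> = cmod and \<iota> = complex_of_real])
      (auto simp: norm_scaleC scaleC_of_real)
qed

end
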